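(* Let $n\ge1$, let $M\le N$ be integers and let $0\le s\le n$. Let $\mathcal P_s$ be the set of pure diagrams lying in $B_{M,N}$ of codimension at least $s$. Then the simplicial fan of pure diagrams in $B^s_{M,N}$, i.e. the union over all chains $C\subseteq\mathcal P_s$ of the cones $\{\sum_{\pi\in C}\lambda_\pi\pi:\lambda_\pi\ge 0\}$, is a convex subset of $B^s_{M,N}$.
   Context: $B_{M,N}$ is the $\mathbb Q$-vector space of arrays $\beta=(\beta_{i,j})$ indexed by $0\le i\le n$, $j\in\mathbb Z$, with $\beta_{i,j}=0$ unless $M+i\le j\le N+i$. $B^s_{M,N}$ is the subspace of $\beta$ satisfying $\sum_{i=0}^n\sum_j(-1)^i\beta_{i,j}j^m=0$ for $m=0,\dots,s-1$. For integers $d_0<d_1<\dots<d_t$ with $0\le t\le n$, the pure diagram $\pi(d_0,\dots,d_t)$ is the array whose entry in position $(i,d_i)$ is $(-1)^i\prod_{0\le j\le t,\,j\ne i}\frac{1}{d_j-d_i}$ for $i=0,\dots,t$, and whose other entries are $0$; its codimension is $t$. It lies in $B_{M,N}$ iff $M+i\le d_i\le N+i$ for all $i$. Partial order: $\pi(d_0,\dots,d_t)\le\pi(d'_0,\dots,d'_u)$ iff $t\ge u$ and $d_i\le d'_i$ for $i=0,\dots,u$. A chain is a totally ordered subset. *)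

theory Defs
  imports Complex_Main
begin

type_synonym diagram = "nat \<Rightarrow> int \<Rightarrow> rat"

definition B :: "nat \<Rightarrow> int \<Rightarrow> int \<Rightarrow> diagram set" where
  "B n M N = {\<beta>. \<forall>i j. \<beta> i j \<noteq> 0 \<longrightarrow> i \<le> n \<and> M + int i \<le> j \<and> j \<le> N + int i}"

definition Bs :: "nat \<Rightarrow> int \<Rightarrow> int \<Rightarrow> nat \<Rightarrow> diagram set" where
  "Bs n M N s = {\<beta> \<in> B n M N. \<forall>m<s.
      (\<Sum>i\<le>n. \<Sum>j\<in>{M + int i..N + int i}. (-1)^i * \<beta> i j * (of_int j) ^ m) = 0}"

definition pure_diagram :: "int list \<Rightarrow> diagram" where
  "pure_diagram d = (\<lambda>i j. if i < length d \<and> j = d ! i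
     then (-1)^i * (\<Prod>k\<in>{0..<length d} - {i}. 1 / of_int (d ! k - d ! i))
     else 0)"

definition codim :: "int list \<Rightarrow> nat" where
  "codim d = length d - 1"

definition degseq :: "nat \<Rightarrow> int list \<Rightarrow> bool" where
  "degseq n d \<longleftrightarrow> d \<noteq> [] \<and> length d \<le> n + 1 \<and> sorted_wrt (<) d"

text \<open>pi(d) lies in B_{M,N} iff M+i \<le> d_i \<le> N+i for all i.\<close>
definition in_BMN :: "int \<Rightarrow> int \<Rightarrow> int list \<Rightarrow> bool" where
  "in_BMN M N d \<longleftrightarrow> (\<forall>i<length d. M + int i \<le> d ! i \<and> d ! i \<le> N + int i)"

definition pure_le :: "int list \<Rightarrow> int list \<Rightarrow> bool" where
  "pure_le d d' \<longleftrightarrow> length d \<ge> length d' \<and> (\<forall>i<length d'. d ! i \<le> d' ! i)"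

definition P :: "nat \<Rightarrow> int \<Rightarrow> int \<Rightarrow> nat \<Rightarrow> int list set" where
  "P n M N s = {d. degseq n d \<and> in_BMN M N d \<and> codim d \<ge> s}"

definition is_chain :: "int list set \<Rightarrow> bool" where
  "is_chain C \<longleftrightarrow> (\<forall>a\<in>C. \<forall>b\<in>C. pure_le a b \<or> pure_le b a)"

definition cone :: "int list set \<Rightarrow> diagram set" where
  "cone C = {\<beta>. \<exists>c::int list \<Rightarrow> rat. (\<forall>d\<in>C. c d \<ge> 0) \<and>
                 \<beta> = (\<lambda>i j. \<Sum>d\<in>C. c d * pure_diagram d i j)}"

definition fan :: "nat \<Rightarrow> int \<Rightarrow> int \<Rightarrow> nat \<Rightarrow> diagram set" where
  "fan n M N s = (\<Union>C\<in>{C. C \<subseteq> P n M N s \<and> finite C \<and> is_chain C}. cone C)"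

definition rat_convex :: "diagram set \<Rightarrow> bool" where
  "rat_convex S \<longleftrightarrow> (\<forall>x\<in>S. \<forall>y\<in>S. \<forall>t::rat. 0 \<le> t \<and> t \<le> 1 \<longrightarrow>
      (\<lambda>i j. t * x i j + (1 - t) * y i j) \<in> S)"

end

(* The fan is the whole cone K generated by the pure diagrams, which is convex. To decompose beta in K
   along a chain, let a be a lower bound of all pure diagrams occurring in beta and subtract the
   largest multiple of pi(a) that leaves the cone generated by the pure diagrams above a; such a
   multiple exists because finitely generated cones are polyhedral. What is left is a combination
   of pure diagrams that have a common lower bound strictly above a, and one recurses.
   The strict increase comes from an exchange relation: for any x and y, pi(x) + C pi(y) is a positive
   multiple of pi(x meet y) plus a nonnegative combination of pure diagrams obtained by mixing the
   rows of x and y. Its coefficients come from writing the products of cross ratios that compare pi(x)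
   with pi(x meet y) as nonnegative combinations of the corresponding products for mixed sequences. *)
theory Submission
  imports Defs "HOL-Computational_Algebra.Polynomial"
begin

section \<open>Cross-ratio expansions\<close>

text \<open>Why the recursion moves strictly up: a small multiple of each pure diagram occurring in
  the remainder can be subtracted without leaving the cone. The exchange relation passes this
  property from x and y to their meet, hence to some common lower bound m of all of them. The
  multiple of pi(a) already removed was maximal, so a lacks the property and m differs from a. This
  needs a strictly positive coefficient at the meet.

  The obstacle in the exchange is that a mixture of rows need not be increasing, so only
  \<open>admissible\<close> mixtures may occur. In the rows q where x lies below y, the quotient of
  pi(x) by the diagram of the meet is a product of Moebius functions of x_q, one for each row where
  x lies above y. The rows where x lies above y pose the same problem in the reversed order, with
  the join in place of the meet. To cover both orders, and the infinite degrees that pad shorter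
  sequences, the expansions are carried out over an abstract bracket: they use only signs,
  antisymmetry and the Pluecker relation.\<close>

locale bracket =
  fixes D :: "'p \<Rightarrow> 'p \<Rightarrow> rat"
  assumes antisym: "D a b = - D b a"
    and plucker: "D w y * D h t - D w t * D h y = D h w * D t y"
begin

text \<open>For \<open>l\<close> the rows of x and \<open>h\<close> those of y, this is the quotient
  of the entries of the diagrams of \<open>mix x y (Q - U)\<close> and \<open>mix x y Q\<close> at
  position (q, x_q). It is 0 for q in U, in accordance with the fact that row q of
  \<open>mix x y (Q - U)\<close> has then left x_q.\<close>

definition ratio_prod :: "('i \<Rightarrow> 'p) \<Rightarrow> ('i \<Rightarrow> 'p) \<Rightarrow> 'i set \<Rightarrow> 'i \<Rightarrow> rat" where
  "ratio_prod l h U q = (\<Prod>u\<in>U. D (l u) (l q) / D (h u) (l q))"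

text \<open>Moving the points \<open>l u\<close> with \<open>u \<in> U\<close> up to \<open>h u\<close> keeps the points in their original order.\<close>
definition admissible :: "('i \<Rightarrow> 'p) \<Rightarrow> ('i \<Rightarrow> 'p) \<Rightarrow> 'i set \<Rightarrow> 'i set \<Rightarrow> bool" where
  "admissible l h Q U \<longleftrightarrow> U \<subseteq> Q \<and>
     (\<forall>u\<in>U. \<forall>q\<in>Q - U. 0 < D (l q) (l u) \<longrightarrow> 0 < D (l q) (h u))"

definition representable :: "('i \<Rightarrow> 'p) \<Rightarrow> ('i \<Rightarrow> 'p) \<Rightarrow> 'i set \<Rightarrow> ('i \<Rightarrow> rat) \<Rightarrow> bool" where
  "representable l h Q \<phi> \<longleftrightarrow> (\<exists>c. (\<forall>U. 0 \<le> c U) \<and>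
     (\<forall>q\<in>Q. \<phi> q = (\<Sum>U | admissible l h Q U. c U * ratio_prod l h U q)))"

lemma same_point [simp]: "D a a = 0"
  using antisym[of a a] by simp

lemma admissible_empty: "admissible l h Q {}"
  by (simp add: admissible_def)

lemma admissible_Un:
  assumes "admissible l h Q U" "admissible l h (Q - U) V"
  shows "admissible l h Q (U \<union> V)"
  using assms unfolding admissible_def by blast

lemma finite_admissible: "finite Q \<Longrightarrow> finite {U. admissible l h Q U}"
  by (rule finite_subset[of _ "Pow Q"]) (auto simp: admissible_def)

lemma ratio_prod_empty [simp]: "ratio_prod l h {} q = 1"
  by (simp add: ratio_prod_def)

lemma ratio_prod_eq_0: "finite U \<Longrightarrow> q \<in> U \<Longrightarrow> ratio_prod l h U q = 0"
  by (auto simp: ratio_prod_def intro!: prod_zero bexI[of _ q])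

lemma ratio_prod_Un:
  assumes "finite U" "finite V" "U \<inter> V = {}"
  shows "ratio_prod l h (U \<union> V) q = ratio_prod l h U q * ratio_prod l h V q"
  using assms by (simp add: ratio_prod_def prod.union_disjoint)

lemma representable_cong:
  "representable l h Q \<phi> \<Longrightarrow> (\<And>q. q \<in> Q \<Longrightarrow> \<psi> q = \<phi> q) \<Longrightarrow> representable l h Q \<psi>"
  by (force simp: representable_def)

lemma representable_zero: "representable l h Q (\<lambda>_. 0)"
  unfolding representable_def by (rule exI[of _ "\<lambda>_. 0"]) simp

lemma representable_add:
  assumes "representable l h Q \<phi>" "representable l h Q \<psi>"
  shows "representable l h Q (\<lambda>q. \<phi> q + \<psi> q)"
proof -
  obtain c d where "\<forall>U. 0 \<le> c U" "\<forall>U. 0 \<le> d U"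
    "\<forall>q\<in>Q. \<phi> q = (\<Sum>U | admissible l h Q U. c U * ratio_prod l h U q)"
    "\<forall>q\<in>Q. \<psi> q = (\<Sum>U | admissible l h Q U. d U * ratio_prod l h U q)"
    using assms unfolding representable_def by auto
  then show ?thesis unfolding representable_def
    by (intro exI[of _ "\<lambda>U. c U + d U"]) (simp add: distrib_right sum.distrib)
qed

lemma representable_scale:
  assumes "representable l h Q \<phi>" "0 \<le> a"
  shows "representable l h Q (\<lambda>q. a * \<phi> q)"
proof -
  obtain c where "\<forall>U. 0 \<le> c U"
    "\<forall>q\<in>Q. \<phi> q = (\<Sum>U | admissible l h Q U. c U * ratio_prod l h U q)"
    using assms unfolding representable_def by auto
  then show ?thesis unfolding representable_def using \<open>0 \<le> a\<close>
    by (intro exI[of _ "\<lambda>U. a * c U"]) (simp add: sum_distrib_left mult.assoc)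
qed

lemma representable_sum:
  assumes "\<And>x. x \<in> A \<Longrightarrow> representable l h Q (\<phi> x)"
  shows "representable l h Q (\<lambda>q. \<Sum>x\<in>A. \<phi> x q)"
  using assms
  by (induction A rule: infinite_finite_induct)
     (auto intro: representable_zero representable_add)

lemma representable_ratio_prod:
  assumes "finite Q" "admissible l h Q U"
  shows "representable l h Q (ratio_prod l h U)"
  unfolding representable_def
proof (intro exI[of _ "\<lambda>V. if V = U then 1 else 0"] conjI ballI allI)
  fix q
  have "(\<Sum>V | admissible l h Q V. (if V = U then 1 else 0) * ratio_prod l h V q)
      = (\<Sum>V | admissible l h Q V. if V = U then ratio_prod l h V q else 0)"
    by (rule sum.cong) auto
  also have "\<dots> = ratio_prod l h U q"
    using assms(2) by (subst sum.delta) (auto simp: finite_admissible[OF assms(1)])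
  finally show "ratio_prod l h U q =
      (\<Sum>V | admissible l h Q V. (if V = U then 1 else 0) * ratio_prod l h V q)" by simp
qed simp

text \<open>Expanding \<phi> on Q - U suffices because \<open>ratio_prod l h U\<close> vanishes on
  U. The index sets unite: first U is moved, then V among the points that stayed.\<close>

lemma representable_mult_ratio_prod:
  assumes "finite Q" "admissible l h Q U" "representable l h (Q - U) \<phi>"
  shows "representable l h Q (\<lambda>q. ratio_prod l h U q * \<phi> q)"
proof -
  obtain c where c: "\<forall>V. 0 \<le> c V"
    "\<forall>q\<in>Q - U. \<phi> q = (\<Sum>V | admissible l h (Q - U) V. c V * ratio_prod l h V q)"
    using assms(3) unfolding representable_def by auto
  have fin: "finite U" using assms by (auto simp: admissible_def intro: finite_subset)
  have "representable l h Q
      (\<lambda>q. \<Sum>V | admissible l h (Q - U) V. c V * ratio_prod l h (U \<union> V) q)"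
    by (rule representable_sum, rule representable_scale, rule representable_ratio_prod)
       (use assms c admissible_Un in auto)
  then show ?thesis
  proof (rule representable_cong)
    fix q assume "q \<in> Q"
    have "ratio_prod l h (U \<union> V) q = ratio_prod l h U q * ratio_prod l h V q"
      if "admissible l h (Q - U) V" for V
      using that fin assms(1)
      by (intro ratio_prod_Un) (auto simp: admissible_def intro: finite_subset)
    then have "(\<Sum>V | admissible l h (Q - U) V. c V * ratio_prod l h (U \<union> V) q)
       = ratio_prod l h U q * (\<Sum>V | admissible l h (Q - U) V. c V * ratio_prod l h V q)"
      by (simp add: sum_distrib_left mult.left_commute)
    then show "ratio_prod l h U q * \<phi> q =
        (\<Sum>V | admissible l h (Q - U) V. c V * ratio_prod l h (U \<union> V) q)"
      using c(2) \<open>q \<in> Q\<close> ratio_prod_eq_0[OF fin, of q l h] by (cases "q \<in> U") auto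
  qed
qed

text \<open>The empty index set contributes the constant 1, which in the exchange stands for the
  mixture \<open>mix x y Q\<close> itself. Splitting off e secures a positive coefficient
  there.\<close>

definition strictly_representable ::
    "('i \<Rightarrow> 'p) \<Rightarrow> ('i \<Rightarrow> 'p) \<Rightarrow> 'i set \<Rightarrow> ('i \<Rightarrow> rat) \<Rightarrow> bool" where
  "strictly_representable l h Q \<phi> \<longleftrightarrow> (\<exists>e>0. representable l h Q (\<lambda>q. \<phi> q - e))"

definition chain_compatible :: "('i \<Rightarrow> 'p) \<Rightarrow> ('i \<Rightarrow> 'p) \<Rightarrow> 'i set \<Rightarrow> bool" where
  "chain_compatible l h Q \<longleftrightarrow> (\<forall>q\<in>Q. \<forall>q'\<in>Q.
     (q \<noteq> q' \<longrightarrow> D (l q) (l q') \<noteq> 0) \<and> (0 < D (l q) (l q') \<longrightarrow> 0 < D (h q) (l q')))"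

text \<open>Read \<open>0 < D a b\<close> as "a lies above b". No move from \<open>l q\<close> to
  \<open>h q\<close> crosses b, hence none passes a point on the far side of b. The latter is a
  separate clause because the signs of a bracket need not be transitive.\<close>

definition separates :: "('i \<Rightarrow> 'p) \<Rightarrow> ('i \<Rightarrow> 'p) \<Rightarrow> 'i set \<Rightarrow> 'p \<Rightarrow> bool" where
  "separates l h Q b \<longleftrightarrow> (\<forall>q\<in>Q. 0 < D b (l q) * D b (h q)) \<and>
     (\<forall>q\<in>Q. \<forall>q'\<in>Q. D b (l q) * D b (l q') < 0 \<longrightarrow> 0 < D (l q') (l q) \<longrightarrow> 0 < D (l q') (h q))"

text \<open>Greedy: subtracting the minimum, attained at \<open>t\<close>, leaves a function vanishing at \<open>t\<close>, and by
  the Pluecker relation it is \<open>ratio_prod l h {t}\<close> times a function of the same form with \<open>w\<close>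
  replaced by \<open>h t\<close>.\<close>
lemma representable_moebius:
  assumes "finite Q" "chain_compatible l h Q" "separates l h Q b"
    and "0 < r * D b w" "\<And>q. q \<in> Q \<Longrightarrow> 0 \<le> r * D w (l q) / D b (l q)"
  shows "representable l h Q (\<lambda>q. r * D w (l q) / D b (l q))
    \<and> ((\<forall>q\<in>Q. 0 < r * D w (l q) / D b (l q)) \<longrightarrow>
       strictly_representable l h Q (\<lambda>q. r * D w (l q) / D b (l q)))"
  using assms
proof (induction "card Q" arbitrary: Q r w)
  case 0
  then show ?case
    by (auto simp: representable_def strictly_representable_def intro: exI[of _ "\<lambda>_. 0"] exI[of _ 1])
next
  case (Suc k)
  let ?f = "\<lambda>q. r * D w (l q) / D b (l q)"
  have "Q \<noteq> {}" using Suc.hyps(2) by auto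
  then obtain t where t: "t \<in> Q" "\<And>q. q \<in> Q \<Longrightarrow> ?f t \<le> ?f q"
    using ex_is_arg_min_if_finite[OF \<open>finite Q\<close>, of ?f] by (auto simp: is_arg_min_linorder)
  \<comment> \<open>Chosen so that the difference computed in \<open>diff\<close> becomes
    \<open>ratio_prod l h {t} q * ?f' q\<close>, with \<open>D (h t) (l q)\<close>
    cancelling.\<close>
  define r' where "r' = r * D b w / D b (l t)"
  let ?f' = "\<lambda>q. r' * D (h t) (l q) / D b (l q)"
  have nz: "D b (l q) \<noteq> 0" if "q \<in> Q" for q
    using Suc.prems(3) that by (auto simp: separates_def)
  have diff: "?f q - ?f t = r * D b w * D (l t) (l q) / (D b (l q) * D b (l t))"
    if "q \<in> Q" for q
  proof -
    have "?f q - ?f t = r * (D w (l q) * D b (l t) - D w (l t) * D b (l q)) / (D b (l q) * D b (l t))"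
      using nz[OF that] nz[OF t(1)] by (simp add: field_simps)
    then show ?thesis by (simp only: plucker mult.assoc)
  qed
  \<comment> \<open>For a point above \<open>l t\<close> the numerator in \<open>diff\<close> is
    negative, so minimality of t forces the two denominators to have opposite signs: b separates the
    points. By \<open>separates\<close> the move to \<open>h t\<close> then stays below that point,
    which makes {t} admissible.\<close>
  have above: "0 < D (l q) (h t)" if "q \<in> Q" "0 < D (l q) (l t)" for q
  proof -
    have "0 \<le> ?f q - ?f t" using t(2)[OF that(1)] by simp
    then have "0 \<le> r * D b w * D (l t) (l q) / (D b (l q) * D b (l t))"
      by (simp only: diff[OF that(1)])
    moreover have "r * D b w * D (l t) (l q) < 0"
      using that(2) antisym[of "l t" "l q"] Suc.prems(4) by (simp add: mult_pos_neg)
    ultimately have "D b (l q) * D b (l t) < 0"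
      using nz[OF that(1)] nz[OF t(1)] by (simp add: zero_le_divide_iff order.strict_iff_order)
    then show ?thesis
      using Suc.prems(3) that t(1) unfolding separates_def mult.commute[of "D b (l q)"] by blast
  qed
  have g_pos: "0 < D (l t) (l q) / D (h t) (l q)" if "q \<in> Q - {t}" for q
  proof (cases "0 < D (l t) (l q)")
    case True
    then show ?thesis using Suc.prems(2) that t(1) by (auto simp: chain_compatible_def)
  next
    case False
    then have "0 < D (l q) (l t)"
      using antisym[of "l t" "l q"] Suc.prems(2) that t(1) by (force simp: chain_compatible_def)
    then show ?thesis
      using above[of q] that antisym[of "l t" "l q"] antisym[of "h t" "l q"]
      by (simp add: divide_neg_neg)
  qed
  have split: "?f q - ?f t = ratio_prod l h {t} q * ?f' q" if "q \<in> Q" for q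
  proof (cases "q = t")
    case True
    then show ?thesis by (simp add: ratio_prod_def)
  next
    case False
    then have "D (h t) (l q) \<noteq> 0" using g_pos[of q] that by auto
    then show ?thesis using nz[OF that] nz[OF t(1)]
      by (simp add: diff[OF that] ratio_prod_def r'_def field_simps)
  qed
  have IH: "representable l h (Q - {t}) ?f'"
  proof (rule Suc.hyps(1)[THEN conjunct1])
    show "k = card (Q - {t})" "finite (Q - {t})" using Suc.hyps(2) t(1) Suc.prems(1) by auto
    show "chain_compatible l h (Q - {t})" "separates l h (Q - {t}) b"
      using Suc.prems(2,3) by (auto simp: chain_compatible_def separates_def)
    have "0 < D b (l t) * D b (h t)" using Suc.prems(3) t(1) by (auto simp: separates_def)
    then have "0 < D b (h t) / D b (l t)" by (auto simp: zero_less_mult_iff zero_less_divide_iff)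
    with Suc.prems(4) have "0 < (r * D b w) * (D b (h t) / D b (l t))" by (rule mult_pos_pos)
    then show "0 < r' * D b (h t)" by (simp add: r'_def)
    fix q assume q: "q \<in> Q - {t}"
    then have "0 \<le> ratio_prod l h {t} q * ?f' q" using split[of q] t(2)[of q] by simp
    moreover have "0 < ratio_prod l h {t} q" using g_pos[OF q] by (simp add: ratio_prod_def)
    ultimately show "0 \<le> ?f' q" by (intro mult_left_le_imp_le[of _ 0]) simp_all
  qed
  have adm: "admissible l h Q {t}" using t(1) above by (auto simp: admissible_def)
  have rep: "representable l h Q (\<lambda>q. ?f q - ?f t)"
    by (rule representable_cong[OF representable_mult_ratio_prod[OF Suc.prems(1) adm IH]])
       (use split in simp)
  have "representable l h Q (\<lambda>q. ?f t * ratio_prod l h {} q)"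
    by (rule representable_scale[OF representable_ratio_prod[OF Suc.prems(1) admissible_empty]])
       (rule Suc.prems(5)[OF t(1)])
  from representable_add[OF rep this] have "representable l h Q ?f"
    by (rule representable_cong) simp
  moreover have "strictly_representable l h Q ?f" if "\<forall>q\<in>Q. 0 < ?f q"
    unfolding strictly_representable_def using rep that t(1) by blast
  ultimately show ?case by blast
qed

text \<open>Factors are multiplied in one at a time. A term with index set U only needs the new
  factor expanded on Q - U, which is why \<open>single\<close> treats every subset of Q. The
  positive constants multiply.\<close>

lemma strictly_representable_prod:
  assumes "finite Q" "chain_compatible l h Q" "finite R"
    and "\<And>r. r \<in> R \<Longrightarrow> separates l h Q (b r)" "\<And>r. r \<in> R \<Longrightarrow> 0 < D (b r) (a r)"
    and "\<And>r q. r \<in> R \<Longrightarrow> q \<in> Q \<Longrightarrow> 0 < D (a r) (l q) / D (b r) (l q)"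
  shows "strictly_representable l h Q (\<lambda>q. \<Prod>r\<in>R. D (a r) (l q) / D (b r) (l q))"
  using assms(3-)
proof (induction R rule: finite_induct)
  case empty
  have "representable l h Q (\<lambda>q. 1 - 1)" by (simp add: representable_zero)
  then show ?case unfolding strictly_representable_def by (auto intro: exI[of _ 1])
next
  case (insert s R)
  let ?\<phi> = "\<lambda>q. \<Prod>r\<in>R. D (a r) (l q) / D (b r) (l q)" and ?\<rho> = "\<lambda>q. D (a s) (l q) / D (b s) (l q)"
  have single: "representable l h Q' ?\<rho> \<and> strictly_representable l h Q' ?\<rho>" if "Q' \<subseteq> Q" for Q'
  proof -
    have pos: "0 < 1 * D (a s) (l q) / D (b s) (l q)" if "q \<in> Q'" for q
      using insert.prems(3)[of s q] that \<open>Q' \<subseteq> Q\<close> by auto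
    have "finite Q'" using that assms(1) by (rule finite_subset)
    moreover have "chain_compatible l h Q'" "separates l h Q' (b s)"
      using assms(2) insert.prems(1)[of s] that
      by (auto simp: chain_compatible_def separates_def subset_iff)
    moreover have "0 < 1 * D (b s) (a s)" using insert.prems(2) by simp
    ultimately show ?thesis
      using representable_moebius[of Q' l h "b s" 1 "a s"] pos less_imp_le[OF pos] by simp
  qed
  obtain e where e: "e > 0" "representable l h Q (\<lambda>q. ?\<phi> q - e)"
    using insert.IH insert.prems unfolding strictly_representable_def by auto
  obtain e' where e': "e' > 0" "representable l h Q (\<lambda>q. ?\<rho> q - e')"
    using single[of Q] by (auto simp: strictly_representable_def)
  obtain c where c: "\<forall>U. 0 \<le> c U"
    "\<forall>q\<in>Q. ?\<phi> q - e = (\<Sum>U | admissible l h Q U. c U * ratio_prod l h U q)"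
    using e(2) unfolding representable_def by auto
  have "representable l h Q (\<lambda>q. \<Sum>U | admissible l h Q U. c U * (ratio_prod l h U q * ?\<rho> q))"
    by (intro representable_sum representable_scale representable_mult_ratio_prod assms(1))
       (use c single in auto)
  from representable_add[OF this representable_scale[OF e'(2) less_imp_le[OF e(1)]]]
  have "representable l h Q (\<lambda>q. ?\<rho> q * ?\<phi> q - e * e')"
  proof (rule representable_cong)
    fix q assume "q \<in> Q"
    then have "(\<Sum>U | admissible l h Q U. c U * (ratio_prod l h U q * ?\<rho> q)) = (?\<phi> q - e) * ?\<rho> q"
      using c(2) by (simp only: sum_distrib_right mult.assoc)
    moreover have "x * y - e * e' = (y - e) * x + e * (x - e')" for x y :: rat
      by (simp add: algebra_simps)
    ultimately show "?\<rho> q * ?\<phi> q - e * e' =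
       (\<Sum>U | admissible l h Q U. c U * (ratio_prod l h U q * ?\<rho> q)) + e * (?\<rho> q - e')"
      by (simp only:)
  qed
  moreover have "0 < e * e'" using e(1) e'(1) by (rule mult_pos_pos)
  ultimately have "strictly_representable l h Q (\<lambda>q. ?\<rho> q * ?\<phi> q)"
    unfolding strictly_representable_def by blast
  then show ?case using insert.hyps by simp
qed

end

section \<open>Moments of pure diagrams\<close>

text \<open>Up to sign the sum is the coefficient of degree \<open>card I - 1\<close> of the
  Lagrange interpolant of p at the nodes. The interpolant is p itself, whose degree is
  smaller.\<close>

lemma divided_difference_eq_0:
  fixes a :: "'i \<Rightarrow> rat"
  assumes "finite I" "inj_on a I" "degree p + 1 < card I"
  shows "(\<Sum>i\<in>I. poly p (a i) / (\<Prod>k\<in>I - {i}. a k - a i)) = 0"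
proof -
  \<comment> \<open>The factors are a k - X, not X - a k, so that the value at a i is exactly the
    denominator; hence the sign in the leading coefficient.\<close>
  define l where "l i = (\<Prod>k\<in>I - {i}. [:a k, -1:])" for i
  define w where "w i = poly p (a i) / (\<Prod>k\<in>I - {i}. a k - a i)" for i
  define q where "q = (\<Sum>i\<in>I. smult (w i) (l i))"
  have deg: "degree (l i) = card I - 1" "coeff (l i) (card I - 1) = (-1) ^ (card I - 1)"
    if "i \<in> I" for i
  proof -
    have "degree (l i) = (\<Sum>k\<in>I - {i}. degree [:a k, -1:])"
      unfolding l_def by (rule degree_prod_eq_sum_degree) auto
    then show d: "degree (l i) = card I - 1" using assms(1) that by simp
    have "lead_coeff (l i) = (-1) ^ (card I - 1)"
      unfolding l_def lead_coeff_prod using assms(1) that by simp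
    then show "coeff (l i) (card I - 1) = (-1) ^ (card I - 1)" using d by simp
  qed
  have "q = p"
  proof (rule poly_eqI_degree)
    fix z assume "z \<in> a ` I"
    then obtain j where j: "j \<in> I" "z = a j" by auto
    have "poly (l i) (a j) = 0" if "i \<in> I" "i \<noteq> j" for i
      using that j assms(1) by (auto simp: l_def poly_prod intro!: bexI[of _ j])
    then have "poly q (a j) = w j * poly (l j) (a j)"
      unfolding q_def poly_sum using assms(1) j(1) by (subst sum.remove[of _ j]) auto
    also have "\<dots> = poly p (a j)"
      using assms(1,2) j(1) by (auto simp: w_def l_def poly_prod inj_on_def)
    finally show "poly q z = poly p z" using j by simp
  next
    have "degree q \<le> card I - 1"
      unfolding q_def using deg(1)
      by (intro degree_sum_le assms(1)) (metis degree_smult_le)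
    then show "degree q < card (a ` I)" "degree p < card (a ` I)"
      using assms by (auto simp: card_image)
  qed
  then have "coeff q (card I - 1) = 0" using assms(3) by (simp add: coeff_eq_0)
  then have "(\<Sum>i\<in>I. w i) * (-1) ^ (card I - 1) = 0"
    by (simp add: q_def coeff_sum deg(2) sum_distrib_right del: One_nat_def)
  then show ?thesis by (simp add: w_def)
qed

lemma sum_poly_eq_0:
  fixes a r :: "'i \<Rightarrow> rat"
  assumes "\<And>m. m < N \<Longrightarrow> (\<Sum>i\<in>I. r i * a i ^ m) = 0" "degree p < N"
  shows "(\<Sum>i\<in>I. r i * poly p (a i)) = 0"
proof -
  have "(\<Sum>i\<in>I. r i * poly p (a i)) = (\<Sum>i\<in>I. \<Sum>m\<le>degree p. coeff p m * (r i * a i ^ m))"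
    by (simp add: poly_altdef sum_distrib_left mult.left_commute)
  also have "\<dots> = (\<Sum>m\<le>degree p. coeff p m * (\<Sum>i\<in>I. r i * a i ^ m))"
    by (subst sum.swap) (simp add: sum_distrib_left)
  also have "\<dots> = 0" using assms by simp
  finally show ?thesis .
qed

text \<open>The equations form a Vandermonde system with a one-dimensional solution space, and
  \<open>divided_difference_eq_0\<close> supplies a nonzero solution.\<close>

lemma moments_determine_weights:
  fixes a r :: "'i \<Rightarrow> rat"
  assumes "finite I" "inj_on a I"
    and "\<And>m. m + 1 < card I \<Longrightarrow> (\<Sum>i\<in>I. r i * a i ^ m) = 0"
  shows "\<exists>c. \<forall>i\<in>I. r i = c / (\<Prod>k\<in>I - {i}. a k - a i)"
proof (cases "I = {}")
  case False
  then obtain i0 where i0: "i0 \<in> I" by auto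
  define w where "w i = 1 / (\<Prod>k\<in>I - {i}. a k - a i)" for i
  have nz: "w i \<noteq> 0" if "i \<in> I" for i
    using that assms(1,2) by (auto simp: w_def inj_on_def)
  define c where "c = r i0 / w i0"
  define r' where "r' i = r i - c * w i" for i
  have 0: "r' i0 = 0" using nz[OF i0] by (simp add: r'_def c_def)
  have mom: "(\<Sum>i\<in>I. r' i * a i ^ m) = 0" if "m < card I - 1" for m
  proof -
    have "(\<Sum>i\<in>I. w i * a i ^ m) = 0"
      using divided_difference_eq_0[OF assms(1,2), of "monom 1 m"] that
      by (simp add: w_def poly_monom degree_monom_eq)
    moreover have "(\<Sum>i\<in>I. r' i * a i ^ m)
        = (\<Sum>i\<in>I. r i * a i ^ m) - c * (\<Sum>i\<in>I. w i * a i ^ m)"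
      by (simp add: r'_def algebra_simps sum_subtractf sum_distrib_left)
    ultimately show ?thesis using assms(3)[of m] that by simp
  qed
  have "r' j = 0" if j: "j \<in> I" "j \<noteq> i0" for j
  proof -
    \<comment> \<open>This vanishes at all nodes except i0 and j, and r' is 0 at i0, so testing r'
      against p isolates r' j. Its degree \<open>card I - 2\<close> is the largest that the moment
      equations reach.\<close>
    define p where "p = (\<Prod>k\<in>I - {i0, j}. [:- a k, 1:])"
    have c2: "card (I - {i0, j}) = card I - 2"
      using i0 j assms(1) by (simp add: card_Diff_subset)
    have c2': "2 \<le> card I"
      using card_mono[OF assms(1), of "{i0, j}"] i0 j by simp
    have "degree p = (\<Sum>k\<in>I - {i0, j}. degree [:- a k, 1:])"
      unfolding p_def by (rule degree_prod_eq_sum_degree) auto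
    then have "degree p < card I - 1" using c2 c2' by simp
    from sum_poly_eq_0[OF mom this] have "(\<Sum>i\<in>I. r' i * poly p (a i)) = 0" by simp
    moreover have "r' i * poly p (a i) = 0" if "i \<in> I - {j}" for i
      using that 0 assms(1) by (cases "i = i0") (auto simp: p_def poly_prod intro!: bexI[of _ i])
    ultimately have "r' j * poly p (a j) = 0"
      using sum.remove[OF assms(1) j(1), of "\<lambda>i. r' i * poly p (a i)"] by simp
    moreover have "poly p (a j) \<noteq> 0"
      using assms(1,2) j by (auto simp: p_def poly_prod inj_on_def)
    ultimately show ?thesis by simp
  qed
  with 0 have "\<forall>i\<in>I. r i = c * w i" unfolding r'_def by (metis right_minus_eq)
  then show ?thesis by (auto simp: w_def)
qed simp

section \<open>The Herzog-Kuehl equations for pure diagrams\<close>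

lemma degseq_nth_less: "degseq n d \<Longrightarrow> i < j \<Longrightarrow> j < length d \<Longrightarrow> d ! i < d ! j"
  by (simp add: degseq_def sorted_wrt_nth_less)

lemma degseq_inj: "degseq n d \<Longrightarrow> inj_on (\<lambda>i. rat_of_int (d ! i)) {..<length d}"
  unfolding inj_on_def by (metis degseq_nth_less lessThan_iff linorder_neqE_nat of_int_eq_iff order_less_irrefl)

lemma pure_diagram_nth:
  "i < length d \<Longrightarrow> pure_diagram d i (d ! i) =
     (-1) ^ i / (\<Prod>k\<in>{..<length d} - {i}. of_int (d ! k) - of_int (d ! i))"
  by (simp add: pure_diagram_def prod_dividef atLeast0LessThan)

lemma pure_diagram_eq_0: "\<not> (i < length d \<and> j = d ! i) \<Longrightarrow> pure_diagram d i j = 0"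
  by (auto simp: pure_diagram_def)

lemma moment_of_support:
  assumes "length d \<le> n + 1" "in_BMN M N d"
    and "\<And>i j. \<beta> i j \<noteq> 0 \<Longrightarrow> i < length d \<and> j = d ! i"
  shows "(\<Sum>i\<le>n. \<Sum>j\<in>{M + int i..N + int i}. (-1)^i * \<beta> i j * (of_int j) ^ m)
       = (\<Sum>i<length d. (-1)^i * \<beta> i (d ! i) * (of_int (d ! i)) ^ m :: rat)"
proof -
  have row: "(\<Sum>j\<in>{M + int i..N + int i}. (-1)^i * \<beta> i j * (of_int j) ^ m)
      = (-1)^i * \<beta> i (d ! i) * (of_int (d ! i)) ^ m" if "i < length d" for i
  proof -
    have "d ! i \<in> {M + int i..N + int i}" using assms(2) that by (auto simp: in_BMN_def)
    then show ?thesis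
      using assms(3)[of i] by (subst sum.remove[of _ "d ! i"]) (auto intro!: sum.neutral)
  qed
  have "(\<Sum>i\<le>n. \<Sum>j\<in>{M + int i..N + int i}. (-1)^i * \<beta> i j * (of_int j) ^ m)
      = (\<Sum>i<length d. \<Sum>j\<in>{M + int i..N + int i}. (-1)^i * \<beta> i j * (of_int j) ^ m)"
  proof (rule sum.mono_neutral_right)
    show "\<forall>i\<in>{..n} - {..<length d}.
        (\<Sum>j\<in>{M + int i..N + int i}. (-1)^i * \<beta> i j * (of_int j) ^ m) = 0"
      using assms(3) by (auto intro!: sum.neutral)
  qed (use assms(1) in auto)
  also have "\<dots> = (\<Sum>i<length d. (-1)^i * \<beta> i (d ! i) * (of_int (d ! i)) ^ m)"
    by (intro sum.cong refl row) simp
  finally show ?thesis .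
qed

lemma pure_diagram_in_Bs:
  assumes "d \<in> P n M N s"
  shows "pure_diagram d \<in> Bs n M N s"
proof -
  have d: "degseq n d" "in_BMN M N d" "s \<le> length d - 1"
    using assms by (auto simp: P_def codim_def)
  then have len: "length d \<le> n + 1" by (simp add: degseq_def)
  have "pure_diagram d \<in> B n M N"
    using d(2) len by (auto simp: B_def in_BMN_def pure_diagram_def split: if_splits)
  moreover have "(\<Sum>i\<le>n. \<Sum>j\<in>{M + int i..N + int i}.
      (-1)^i * pure_diagram d i j * (of_int j) ^ m) = 0" if "m < s" for m
  proof -
    have "(\<Sum>i\<le>n. \<Sum>j\<in>{M + int i..N + int i}. (-1)^i * pure_diagram d i j * (of_int j) ^ m)
       = (\<Sum>i<length d. (-1)^i * pure_diagram d i (d ! i) * (of_int (d ! i)) ^ m)"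
      by (rule moment_of_support[OF len d(2)]) (use pure_diagram_eq_0 in blast)
    also have "\<dots> = (\<Sum>i<length d. poly (monom 1 m) (of_int (d ! i)) /
        (\<Prod>k\<in>{..<length d} - {i}. of_int (d ! k) - of_int (d ! i)))"
    proof (intro sum.cong refl)
      fix i assume "i \<in> {..<length d}"
      moreover have "(-1)^i * ((-1)^i / z) = 1 / z" for z :: rat
        by (cases "even i") auto
      ultimately show "(-1)^i * pure_diagram d i (d ! i) * (of_int (d ! i)) ^ m =
          poly (monom 1 m) (of_int (d ! i)) /
          (\<Prod>k\<in>{..<length d} - {i}. of_int (d ! k) - of_int (d ! i))"
        by (simp add: pure_diagram_nth poly_monom)
    qed
    also have "\<dots> = 0"
      by (rule divided_difference_eq_0[OF _ degseq_inj[OF d(1)]])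
         (use that d(3) in \<open>simp_all add: degree_monom_eq\<close>)
    finally show ?thesis .
  qed
  ultimately show ?thesis by (simp add: Bs_def)
qed

text \<open>On \<open>length d\<close> positions the \<open>length d - 1\<close> moment equations
  leave one degree of freedom. This identifies the remainder in \<open>exchange\<close>.\<close>

lemma supported_eq_multiple_pure_diagram:
  assumes "\<beta> \<in> Bs n M N (length d - 1)" "degseq n d" "in_BMN M N d"
    and supp: "\<And>i j. \<beta> i j \<noteq> 0 \<Longrightarrow> i < length d \<and> j = d ! i"
  shows "\<exists>c. \<forall>i j. \<beta> i j = c * pure_diagram d i j"
proof -
  have len: "length d \<le> n + 1" using assms(2) by (simp add: degseq_def)
  have "(\<Sum>i<length d. (-1)^i * \<beta> i (d ! i) * (of_int (d ! i)) ^ m) = 0"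
    if "m + 1 < card {..<length d}" for m
  proof -
    have "(\<Sum>i<length d. (-1)^i * \<beta> i (d ! i) * (of_int (d ! i)) ^ m) =
      (\<Sum>i\<le>n. \<Sum>j\<in>{M + int i..N + int i}. (-1)^i * \<beta> i j * (of_int j) ^ m)"
      by (rule moment_of_support[OF len assms(3), symmetric]) (fact supp)
    also have "\<dots> = 0" using assms(1) that by (simp add: Bs_def)
    finally show ?thesis .
  qed
  from moments_determine_weights[OF _ degseq_inj[OF assms(2)] this]
  obtain c where c: "\<forall>i\<in>{..<length d}. (-1)^i * \<beta> i (d ! i) =
      c / (\<Prod>k\<in>{..<length d} - {i}. of_int (d ! k) - of_int (d ! i))" by auto
  have "\<beta> i j = c * pure_diagram d i j" for i j
  proof (cases "i < length d \<and> j = d ! i")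
    case True
    then have "(-1)^i * ((-1)^i * \<beta> i j) = c * pure_diagram d i j"
      using c by (simp add: pure_diagram_nth)
    moreover have "(-1)^i * ((-1)^i * z) = z" for z :: rat
      by (cases "even i") auto
    ultimately show ?thesis by simp
  qed (use supp pure_diagram_eq_0 in force)
  then show ?thesis by blast
qed

lemma Bs_combination:
  assumes "\<beta> \<in> Bs n M N s" "\<gamma> \<in> Bs n M N s"
  shows "(\<lambda>i j. a * \<beta> i j + b * \<gamma> i j) \<in> Bs n M N s"
proof -
  have "(\<Sum>i\<le>n. \<Sum>j\<in>{M + int i..N + int i}. (-1)^i * (a * \<beta> i j + b * \<gamma> i j) * (of_int j) ^ m)
     = a * (\<Sum>i\<le>n. \<Sum>j\<in>{M + int i..N + int i}. (-1)^i * \<beta> i j * (of_int j) ^ m)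
     + b * (\<Sum>i\<le>n. \<Sum>j\<in>{M + int i..N + int i}. (-1)^i * \<gamma> i j * (of_int j) ^ m)" for m
    by (simp add: sum_distrib_left algebra_simps sum.distrib)
  moreover have "a * \<beta> i j + b * \<gamma> i j = 0" if "\<beta> i j = 0" "\<gamma> i j = 0" for i j
    using that by simp
  then have "(\<lambda>i j. a * \<beta> i j + b * \<gamma> i j) \<in> B n M N"
    using assms unfolding Bs_def B_def mem_Collect_eq by metis
  ultimately show ?thesis using assms unfolding Bs_def mem_Collect_eq by simp
qed

lemma zero_in_Bs: "(\<lambda>i j. 0) \<in> Bs n M N s"
  by (simp add: Bs_def B_def)

lemma cone_subset_Bs:
  assumes "C \<subseteq> P n M N s" "finite C"
  shows "cone C \<subseteq> Bs n M N s"
proof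
  fix \<beta> assume "\<beta> \<in> cone C"
  then obtain c where \<beta>: "\<beta> = (\<lambda>i j. \<Sum>d\<in>C. c d * pure_diagram d i j)" by (auto simp: cone_def)
  have "(\<lambda>i j. \<Sum>d\<in>C. c d * pure_diagram d i j) \<in> Bs n M N s"
    using assms(2,1)
  proof (induction C rule: finite_induct)
    case (insert d C)
    then show ?case
      using Bs_combination[of "pure_diagram d" n M N s _ "c d" 1] pure_diagram_in_Bs by simp
  qed (simp add: zero_in_Bs)
  then show "\<beta> \<in> Bs n M N s" by (simp add: \<beta>)
qed

section \<open>Exchange of two pure diagrams\<close>

text \<open>Differences of degrees, with \<open>None\<close> an infinite degree. The values at \<open>None\<close> are the limits
  after rescaling: letting the last degree of a pure diagram tend to infinity truncates it.\<close>
fun gap :: "int option \<Rightarrow> int option \<Rightarrow> rat" where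
  "gap (Some a) (Some b) = of_int (a - b)"
| "gap None (Some b) = 1"
| "gap (Some a) None = -1"
| "gap None None = 0"

definition row :: "int list \<Rightarrow> nat \<Rightarrow> int option" where
  "row z k = (if k < length z then Some (z ! k) else None)"

text \<open>\<open>gap\<close> is the 2x2 determinant of homogeneous coordinates, (v, 1) for
  \<open>Some v\<close> and (1, 0) for \<open>None\<close>, so the Pluecker relation persists at
  infinity.\<close>

lemma bracket_gap: "bracket gap"
proof
  fix a b w y h t :: "int option"
  show "gap a b = - gap b a" by (cases a; cases b) auto
  show "gap w y * gap h t - gap w t * gap h y = gap h w * gap t y"
    by (cases w; cases y; cases h; cases t) (auto simp: algebra_simps)
qed

lemma bracket_gap_swap: "bracket (\<lambda>a b. gap b a)"
proof
  fix a b w y h t :: "int option"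
  show "gap b a = - gap a b" by (cases a; cases b) auto
  show "gap y w * gap t h - gap t w * gap y h = gap w h * gap y t"
    by (cases w; cases y; cases h; cases t) (auto simp: algebra_simps)
qed

lemma gap_swap: "gap b a = - gap a b"
  by (cases a; cases b) auto

lemma gap_eq_0_iff: "gap a b = 0 \<longleftrightarrow> a = b"
  by (cases a; cases b) auto

lemma gap_trans: "0 < gap q p \<Longrightarrow> 0 < gap r q \<Longrightarrow> 0 < gap r p"
  by (cases p; cases q; cases r) auto

text \<open>Infinite rows contribute the factor 1, so sequences of different lengths become products
  over one common index range.\<close>

lemma pure_diagram_row:
  assumes "i < length z" "length z \<le> L"
  shows "pure_diagram z i (z ! i) = (-1) ^ i / (\<Prod>k\<in>{..<L} - {i}. gap (row z k) (Some (z ! i)))"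
proof -
  have "(\<Prod>k\<in>{..<L} - {i}. gap (row z k) (Some (z ! i)))
      = (\<Prod>k\<in>{..<length z} - {i}. gap (row z k) (Some (z ! i)))"
    using assms by (intro prod.mono_neutral_right) (auto simp: row_def)
  also have "\<dots> = (\<Prod>k\<in>{..<length z} - {i}. of_int (z ! k) - of_int (z ! i))"
    by (intro prod.cong) (auto simp: row_def)
  finally show ?thesis using assms by (simp add: pure_diagram_nth)
qed

lemma pure_diagram_ratio:
  assumes "length z \<le> L" "length z' \<le> L" "sorted_wrt (<) z'"
    and "i < L" "row z i = Some v" "row z' i = Some v" "V \<subseteq> {..<L} - {i}"
    and "\<And>k. k < L \<Longrightarrow> k \<notin> V \<Longrightarrow> row z k = row z' k"
  shows "pure_diagram z i v =
    pure_diagram z' i v * (\<Prod>k\<in>V. gap (row z' k) (Some v) / gap (row z k) (Some v))"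
proof -
  have i: "i < length z" "z ! i = v" "i < length z'" "z' ! i = v"
    using assms(5,6) by (auto simp: row_def split: if_splits)
  have split: "(\<Prod>k\<in>{..<L} - {i}. f k) = (\<Prod>k\<in>V. f k) * (\<Prod>k\<in>{..<L} - {i} - V. f k)"
    for f :: "nat \<Rightarrow> rat"
    using prod.subset_diff[OF assms(7), of f] by simp
  have same: "(\<Prod>k\<in>{..<L} - {i} - V. gap (row z k) (Some v))
      = (\<Prod>k\<in>{..<L} - {i} - V. gap (row z' k) (Some v))"
    using assms(8) by (intro prod.cong) auto
  have "gap (row z' k) (Some v) \<noteq> 0" if "k \<in> V" for k
  proof -
    have "k \<noteq> i" using that assms(7) by auto
    then have "k < length z' \<Longrightarrow> z' ! k \<noteq> z' ! i"
      using sorted_wrt_nth_less[OF assms(3), of k i] sorted_wrt_nth_less[OF assms(3), of i k] i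
      by (cases "k < i") auto
    then show ?thesis using i by (auto simp: gap_eq_0_iff row_def split: if_splits)
  qed
  then have "(\<Prod>k\<in>V. gap (row z' k) (Some v)) \<noteq> 0"
    using finite_subset[OF assms(7)] by auto
  then show ?thesis
    using pure_diagram_row[OF i(1) assms(1)] pure_diagram_row[OF i(3) assms(2)]
    unfolding i(2,4) split same by (simp add: prod_dividef)
qed

section \<open>Closure properties of cones\<close>

lemma cone_zero: "(\<lambda>i j. 0) \<in> cone C"
  by (auto simp: cone_def intro!: exI[of _ "\<lambda>_. 0"])

lemma cone_add:
  assumes "\<beta> \<in> cone C" "\<gamma> \<in> cone C"
  shows "(\<lambda>i j. \<beta> i j + \<gamma> i j) \<in> cone C"
proof -
  obtain c c' where "\<forall>d\<in>C. 0 \<le> c d" "\<beta> = (\<lambda>i j. \<Sum>d\<in>C. c d * pure_diagram d i j)"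
    "\<forall>d\<in>C. 0 \<le> c' d" "\<gamma> = (\<lambda>i j. \<Sum>d\<in>C. c' d * pure_diagram d i j)"
    using assms by (auto simp: cone_def)
  then show ?thesis
    by (auto simp: cone_def sum.distrib distrib_right intro!: exI[of _ "\<lambda>d. c d + c' d"])
qed

lemma cone_scale:
  assumes "\<beta> \<in> cone C" "0 \<le> a"
  shows "(\<lambda>i j. a * \<beta> i j) \<in> cone C"
proof -
  obtain c where "\<forall>d\<in>C. 0 \<le> c d" "\<beta> = (\<lambda>i j. \<Sum>d\<in>C. c d * pure_diagram d i j)"
    using assms by (auto simp: cone_def)
  then show ?thesis using assms(2)
    by (auto simp: cone_def sum_distrib_left mult.assoc intro!: exI[of _ "\<lambda>d. a * c d"])
qed

lemma cone_mono:
  assumes "C \<subseteq> C'" "finite C'"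
  shows "cone C \<subseteq> cone C'"
proof
  fix \<beta> assume "\<beta> \<in> cone C"
  then obtain c where c: "\<forall>d\<in>C. 0 \<le> c d" "\<beta> = (\<lambda>i j. \<Sum>d\<in>C. c d * pure_diagram d i j)"
    by (auto simp: cone_def)
  have "(\<Sum>d\<in>C'. (if d \<in> C then c d else 0) * pure_diagram d i j)
      = (\<Sum>d\<in>C. c d * pure_diagram d i j)" for i j
    using assms by (intro sum.mono_neutral_cong_right) auto
  then show "\<beta> \<in> cone C'" using c
    by (auto simp: cone_def intro!: exI[of _ "\<lambda>d. if d \<in> C then c d else 0"])
qed

lemma pure_diagram_in_cone:
  assumes "finite C" "d \<in> C"
  shows "pure_diagram d \<in> cone C"
proof -
  have "pure_diagram d \<in> cone {d}" by (auto simp: cone_def intro!: exI[of _ "\<lambda>_. 1"])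
  then show ?thesis using cone_mono[of "{d}" C] assms by auto
qed

lemma cone_sum:
  assumes "\<And>x. x \<in> A \<Longrightarrow> (\<lambda>i j. f x i j) \<in> cone C"
  shows "(\<lambda>i j. \<Sum>x\<in>A. f x i j) \<in> cone C"
  using assms
  by (induction A rule: infinite_finite_induct) (auto simp: cone_zero intro: cone_add)

text \<open>The list whose rows in \<open>A\<close> come from \<open>x\<close> and whose other rows come from \<open>y\<close>; a row beyond
  the end of a list counts as infinite.\<close>
definition mix :: "int list \<Rightarrow> int list \<Rightarrow> nat set \<Rightarrow> int list" where
  "mix x y A = map (\<lambda>k. if k \<in> A then x ! k else y ! k) [0..<(LEAST k. length y \<le> k \<and> k \<notin> A)]"

text \<open>Beyond the end of y a row is finite only if it lies in A. By \<open>initial\<close> no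
  finite row follows an infinite one, so a list can hold the mixture.\<close>

lemma row_mix:
  assumes "A \<subseteq> {..<length x}" "length y \<le> length x"
    and initial: "\<And>j k. k \<in> A \<Longrightarrow> length y \<le> j \<Longrightarrow> j < k \<Longrightarrow> j \<in> A"
  shows "row (mix x y A) k = (if k \<in> A then row x k else row y k)"
    and "length y \<le> length (mix x y A)" and "length (mix x y A) \<le> length x"
proof -
  define l where "l = (LEAST k. length y \<le> k \<and> k \<notin> A)"
  have L: "length y \<le> length x \<and> length x \<notin> A" using assms(1,2) by auto
  have l: "length y \<le> l" "l \<notin> A"
    using LeastI[of "\<lambda>k. length y \<le> k \<and> k \<notin> A", OF L] by (auto simp: l_def)
  have lx: "l \<le> length x" unfolding l_def by (rule Least_le) (rule L)
  have len: "length (mix x y A) = l" by (simp add: mix_def l_def)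
  show "length y \<le> length (mix x y A)" "length (mix x y A) \<le> length x" using l lx len by auto
  have in_l: "k < l \<longleftrightarrow> k < length y \<or> k \<in> A"
  proof
    assume "k < l"
    then show "k < length y \<or> k \<in> A"
      using not_less_Least[of k "\<lambda>k. length y \<le> k \<and> k \<notin> A"] by (auto simp: l_def)
  next
    assume "k < length y \<or> k \<in> A"
    then show "k < l" using l initial[of k l] by (metis linorder_less_linear order_less_le_trans)
  qed
  have "mix x y A ! k = (if k \<in> A then x ! k else y ! k)" if "k < l"
    using that by (simp add: mix_def l_def)
  then show "row (mix x y A) k = (if k \<in> A then row x k else row y k)"
    using in_l assms(1) by (auto simp: row_def len)
qed

text \<open>At (q, x_q) the entry of pi(x) is that of \<open>mix x y Q\<close> times a product over
  R. Expanding this product turns each \<open>ratio_prod\<close> into the diagram of an admissible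
  mixture. Quotients of values of D do not see \<sigma>, so one lemma serves both orders.\<close>

lemma exchange_stage:
  fixes D :: "int option \<Rightarrow> int option \<Rightarrow> rat"
  assumes "bracket D"
    and sgn: "\<And>a b. D a b = \<sigma> * gap a b" "\<sigma> = 1 \<or> \<sigma> = -1"
    and Q: "Q \<subseteq> {..<length x}" and R: "R \<subseteq> {..<length x}" and QR: "Q \<inter> R = {}"
    and same: "\<And>k. k < length x \<Longrightarrow> k \<notin> Q \<Longrightarrow> k \<notin> R \<Longrightarrow> row x k = row y k"
    and diff: "\<And>k. k \<in> Q \<Longrightarrow> row x k \<noteq> row y k"
    and strict: "bracket.strictly_representable D (row x) (row y) Q
       (\<lambda>q. \<Prod>r\<in>R. D (row y r) (row x q) / D (row x r) (row x q))"
    and adm: "\<And>U. bracket.admissible D (row x) (row y) Q U \<Longrightarrow> mix x y (Q - U) \<in> F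
       \<and> length (mix x y (Q - U)) \<le> length x \<and> sorted_wrt (<) (mix x y (Q - U))
       \<and> (\<forall>k. row (mix x y (Q - U)) k = (if k \<in> Q - U then row x k else row y k))"
    and F: "finite F"
  shows "\<exists>e>0. \<exists>\<gamma>\<in>cone F.
      (\<forall>q\<in>Q. pure_diagram x q (x ! q) = e * pure_diagram (mix x y Q) q (x ! q) + \<gamma> q (x ! q))
    \<and> (\<forall>i j. \<gamma> i j \<noteq> 0 \<longrightarrow> i \<in> Q \<and> row x i = Some j \<or> row y i = Some j)"
proof -
  interpret bracket D by fact
  have finQ: "finite Q" using Q by (rule finite_subset) simp
  have ratio: "D a b / D c d = gap a b / gap c d" for a b c d
    using sgn by auto
  obtain e where e: "e > 0" "representable (row x) (row y) Q
      (\<lambda>q. (\<Prod>r\<in>R. D (row y r) (row x q) / D (row x r) (row x q)) - e)"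
    using strict by (auto simp: strictly_representable_def)
  then obtain c where c: "\<forall>U. 0 \<le> c U"
    "\<forall>q\<in>Q. (\<Prod>r\<in>R. D (row y r) (row x q) / D (row x r) (row x q)) - e
       = (\<Sum>U | admissible (row x) (row y) Q U. c U * ratio_prod (row x) (row y) U q)"
    by (auto simp: representable_def)
  define \<gamma> where "\<gamma> = (\<lambda>i j. \<Sum>U | admissible (row x) (row y) Q U.
      c U * pure_diagram (mix x y (Q - U)) i j)"
  let ?m = "mix x y Q"
  have m: "length ?m \<le> length x" "sorted_wrt (<) ?m"
      "\<And>k. row ?m k = (if k \<in> Q then row x k else row y k)"
    using adm[OF admissible_empty] by auto
  have rx: "row x k = Some (x ! k)" if "k < length x" for k
    using that by (simp add: row_def)
  have "\<gamma> \<in> cone F"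
    unfolding \<gamma>_def
  proof (rule cone_sum)
    fix U assume "U \<in> {U. admissible (row x) (row y) Q U}"
    then have "pure_diagram (mix x y (Q - U)) \<in> cone F"
      using adm F by (intro pure_diagram_in_cone) auto
    then show "(\<lambda>i j. c U * pure_diagram (mix x y (Q - U)) i j) \<in> cone F"
      using c(1) by (intro cone_scale) auto
  qed
  moreover have "pure_diagram x q (x ! q) = e * pure_diagram ?m q (x ! q) + \<gamma> q (x ! q)"
    if q: "q \<in> Q" for q
  proof -
    have qx: "q < length x" using q Q by auto
    have "pure_diagram x q (x ! q) = pure_diagram ?m q (x ! q) *
        (\<Prod>k\<in>R. gap (row ?m k) (Some (x ! q)) / gap (row x k) (Some (x ! q)))"
      using q qx QR R same
      by (intro pure_diagram_ratio[of x "length x"] m(1,2)) (auto simp: rx m(3))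
    also have "(\<Prod>k\<in>R. gap (row ?m k) (Some (x ! q)) / gap (row x k) (Some (x ! q)))
        = (\<Prod>r\<in>R. D (row y r) (row x q) / D (row x r) (row x q))"
      using QR by (intro prod.cong refl) (auto simp: m(3) ratio rx[OF qx])
    also have "\<dots> = e + (\<Sum>U | admissible (row x) (row y) Q U. c U * ratio_prod (row x) (row y) U q)"
      using c(2)[rule_format, OF q] by linarith
    finally have "pure_diagram x q (x ! q) = e * pure_diagram ?m q (x ! q) +
      (\<Sum>U | admissible (row x) (row y) Q U.
         c U * (pure_diagram ?m q (x ! q) * ratio_prod (row x) (row y) U q))"
      by (simp add: algebra_simps sum_distrib_left)
    moreover have "pure_diagram ?m q (x ! q) * ratio_prod (row x) (row y) U q
        = pure_diagram (mix x y (Q - U)) q (x ! q)"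
      if U: "admissible (row x) (row y) Q U" for U
    proof (cases "q \<in> U")
      case True
      have UQ: "U \<subseteq> Q" using U by (simp add: admissible_def)
      have "row (mix x y (Q - U)) q \<noteq> Some (x ! q)"
        using adm[OF U] True diff[OF q] rx[OF qx] by auto
      then have "pure_diagram (mix x y (Q - U)) q (x ! q) = 0"
        by (intro pure_diagram_eq_0) (auto simp: row_def)
      then show ?thesis using ratio_prod_eq_0[OF finite_subset[OF UQ finQ] True] by simp
    next
      case False
      have UQ: "U \<subseteq> Q" using U by (simp add: admissible_def)
      have "pure_diagram (mix x y (Q - U)) q (x ! q) = pure_diagram ?m q (x ! q) *
        (\<Prod>k\<in>U. gap (row ?m k) (Some (x ! q)) / gap (row (mix x y (Q - U)) k) (Some (x ! q)))"
        using adm[OF U] m q False UQ Q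
        by (intro pure_diagram_ratio[of _ "length x"]) (auto simp: rx[OF qx])
      also have "(\<Prod>k\<in>U. gap (row ?m k) (Some (x ! q)) / gap (row (mix x y (Q - U)) k) (Some (x ! q)))
          = ratio_prod (row x) (row y) U q"
        unfolding ratio_prod_def
        using adm[OF U] m UQ by (intro prod.cong refl) (auto simp: ratio rx[OF qx])
      finally show ?thesis by simp
    qed
    ultimately show ?thesis by (simp add: \<gamma>_def)
  qed
  moreover have "i \<in> Q \<and> row x i = Some j \<or> row y i = Some j" if "\<gamma> i j \<noteq> 0" for i j
  proof -
    have "\<exists>U. admissible (row x) (row y) Q U \<and> pure_diagram (mix x y (Q - U)) i j \<noteq> 0"
      using that unfolding \<gamma>_def by (metis (mono_tags, lifting) mem_Collect_eq mult_zero_right sum.neutral)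
    then obtain U where U: "admissible (row x) (row y) Q U"
        "pure_diagram (mix x y (Q - U)) i j \<noteq> 0" by blast
    then have "row (mix x y (Q - U)) i = Some j"
      using pure_diagram_eq_0[of i "mix x y (Q - U)" j] by (auto simp: row_def)
    then show ?thesis using adm[OF U(1)] by (auto split: if_splits)
  qed
  ultimately show ?thesis using e(1) by blast
qed

lemma finite_P: "finite (P n M N s)"
proof (rule finite_subset)
  show "P n M N s \<subseteq> {d. set d \<subseteq> {M..N + int n} \<and> length d \<le> n + 1}"
  proof
    fix d assume d: "d \<in> P n M N s"
    then have "M \<le> d ! i \<and> d ! i \<le> N + int n" if "i < length d" for i
      using that by (fastforce simp: P_def degseq_def in_BMN_def)
    then show "d \<in> {d. set d \<subseteq> {M..N + int n} \<and> length d \<le> n + 1}"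
      using d by (auto simp: P_def degseq_def in_set_conv_nth)
  qed
  show "finite {d. set d \<subseteq> {M..N + int n} \<and> length d \<le> n + 1}"
    by (rule finite_lists_length_le) simp
qed

lemma row_eq_Some_iff: "row z k = Some v \<longleftrightarrow> k < length z \<and> z ! k = v"
  by (auto simp: row_def)

lemma row_increasing:
  "sorted_wrt (<) z \<Longrightarrow> j < k \<Longrightarrow> j < length z \<Longrightarrow> 0 < gap (row z k) (row z j)"
  by (auto simp: row_def sorted_wrt_nth_less)

text \<open>Only pairs of rows from different lists can violate the order: \<open>lower\<close>
  covers those whose earlier row comes from x, \<open>upper\<close> those whose earlier row comes
  from y.\<close>

lemma mix_in_P:
  assumes "x \<in> P n M N s" "y \<in> P n M N s" "length y \<le> length x" "A \<subseteq> {..<length x}"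
    and lower: "\<And>j k. j < k \<Longrightarrow> k < length x \<Longrightarrow> j \<in> A \<Longrightarrow> k \<notin> A \<Longrightarrow> 0 < gap (row y k) (row x j)"
    and upper: "\<And>j k. j < k \<Longrightarrow> k \<in> A \<Longrightarrow> j \<notin> A \<Longrightarrow> 0 < gap (row x k) (row y j)"
  shows "mix x y A \<in> P n M N s" "length y \<le> length (mix x y A)" "length (mix x y A) \<le> length x"
    "row (mix x y A) k = (if k \<in> A then row x k else row y k)" "sorted_wrt (<) (mix x y A)"
    "pure_le a x \<Longrightarrow> pure_le a y \<Longrightarrow> pure_le a (mix x y A)"
proof -
  let ?z = "mix x y A"
  have initial: "j \<in> A" if "k \<in> A" "length y \<le> j" "j < k" for j k
  proof (rule ccontr)
    assume "j \<notin> A"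
    \<comment> \<open>Row j of y is infinite, and no entry of x lies above it.\<close>
    from upper[OF that(3,1) this] that(2) show False by (auto simp: row_def split: if_splits)
  qed
  show r: "row ?z k = (if k \<in> A then row x k else row y k)" for k
    by (rule row_mix(1)[OF assms(4,3)]) (use initial in blast)
  show len: "length y \<le> length ?z" "length ?z \<le> length x"
    by (rule row_mix(2,3)[OF assms(4,3)]; use initial in blast)+
  have x: "degseq n x" "in_BMN M N x" "s \<le> length x - 1"
    and y: "degseq n y" "in_BMN M N y" "s \<le> length y - 1"
    using assms(1,2) by (auto simp: P_def codim_def)
  have nth: "(k \<in> A \<and> k < length x \<and> ?z ! k = x ! k) \<or> (k \<notin> A \<and> k < length y \<and> ?z ! k = y ! k)"
    if "k < length ?z" for k
    using r[of k] that by (auto simp: row_def split: if_splits)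
  have sx: "sorted_wrt (<) x" and sy: "sorted_wrt (<) y" using x(1) y(1) by (auto simp: degseq_def)
  have "?z ! j < ?z ! k" if "j < k" "k < length ?z" for j k
  proof -
    have "0 < gap (row ?z k) (row ?z j)"
      using nth[of j] nth[of k] that lower[of j k] upper[of j k]
        row_increasing[OF sx that(1)] row_increasing[OF sy that(1)] len(2)
      by (auto simp: r)
    then show ?thesis using that by (auto simp: row_def)
  qed
  then show sz: "sorted_wrt (<) ?z" by (simp add: sorted_wrt_iff_nth_less)
  have "in_BMN M N ?z" using nth x(2) y(2) unfolding in_BMN_def by metis
  moreover have "?z \<noteq> []" using len y(1) by (auto simp: degseq_def)
  ultimately show "?z \<in> P n M N s"
    using sz len x(1) y(3) by (auto simp: P_def degseq_def codim_def)
  show "pure_le a ?z" if "pure_le a x" "pure_le a y"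
    unfolding pure_le_def
  proof (intro conjI allI impI)
    show "length ?z \<le> length a" using that(1) len(2) by (simp add: pure_le_def)
    show "a ! k \<le> ?z ! k" if "k < length ?z" for k
      using nth[OF that] \<open>pure_le a x\<close> \<open>pure_le a y\<close> by (auto simp: pure_le_def)
  qed
qed

text \<open>With \<open>S\<close> and \<open>T\<close> the rows in which \<open>x\<close> lies below, respectively above, \<open>y\<close>, subtract from
  \<open>\<pi>(x)\<close> a nonnegative combination of mixed diagrams with rows from \<open>x\<close> inside \<open>S\<close> that agrees with it
  on \<open>S\<close>, and likewise for \<open>T\<close>. The rest is supported on the positions of \<open>y\<close> and therefore a multiple
  of \<open>\<pi>(y)\<close>. The witness \<open>m\<close> is the meet of \<open>x\<close> and \<open>y\<close>.\<close>
lemma exchange: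
  assumes x: "x \<in> P n M N s" and y: "y \<in> P n M N s" and len: "length y \<le> length x"
    and a: "pure_le a x" "pure_le a y"
  shows "\<exists>m e C. m \<in> P n M N s \<and> pure_le a m \<and> pure_le m x \<and> pure_le m y \<and> 0 < e \<and> 0 \<le> C \<and>
    (\<lambda>i j. pure_diagram x i j + C * pure_diagram y i j - e * pure_diagram m i j)
      \<in> cone {d \<in> P n M N s. pure_le a d}"
proof -
  let ?L = "length x" and ?X = "row x" and ?Y = "row y"
  \<comment> \<open>Rows of x past the end of y fall into S, because y is infinite there.\<close>
  define S where "S = {k. k < ?L \<and> 0 < gap (?Y k) (?X k)}"
  define T where "T = {k. k < ?L \<and> 0 < gap (?X k) (?Y k)}"
  have sx: "sorted_wrt (<) x" and sy: "sorted_wrt (<) y"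
    using x y by (auto simp: P_def degseq_def)
  have xinc: "0 < gap (?X k) (?X j)" if "j < k" "k < ?L" for j k
    using row_increasing[OF sx that(1)] that by simp
  have yinc: "0 < gap (?Y k) (?Y j)" if "j < k" "j < length y" for j k
    using row_increasing[OF sy that] .
  have Ty: "k < length y" if "k \<in> T" for k
    using that by (auto simp: T_def row_def split: if_splits)
  have T: "k < ?L" "0 < gap (?X k) (?Y k)" if "k \<in> T" for k using that by (auto simp: T_def)
  have S: "k < ?L" "0 < gap (?Y k) (?X k)" if "k \<in> S" for k using that by (auto simp: S_def)
  have neg: "gap p q < 0" if "0 < gap q p" for p q using gap_swap[of p q] that by simp
  have ST: "S \<inter> T = {}" using neg by (force simp: S_def T_def)
  have cases: "k \<in> S \<or> k \<in> T \<or> ?X k = ?Y k" if "k < ?L" for k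
    using that gap_swap[of "?Y k" "?X k"] gap_eq_0_iff[of "?X k" "?Y k"]
    by (cases "gap (?X k) (?Y k)" "0 :: rat" rule: linorder_cases) (auto simp: S_def T_def)
  have xneg: "gap (?X j) (?X k) < 0" if "j < k" "k < ?L" for j k
    using xinc[OF that] gap_swap[of "?X j" "?X k"] by simp
  have idx: "j < k" if "0 < gap (?X k) (?X j)" "j < ?L" for j k
    using that xneg[of k j] by (metis gap_eq_0_iff linorder_neqE_nat order_less_asym order_less_irrefl)
  have trans: "0 < gap r p" if "0 < gap q p" "0 < gap r q" for p q r using gap_trans that .
  let ?D = "\<lambda>a b. gap b a"
  interpret up: bracket gap by (rule bracket_gap)
  interpret dn: bracket ?D by (rule bracket_gap_swap)
  have mixS: "mix x y (S - U) \<in> P n M N s \<and> length y \<le> length (mix x y (S - U))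
      \<and> length (mix x y (S - U)) \<le> ?L
      \<and> (\<forall>k. row (mix x y (S - U)) k = (if k \<in> S - U then ?X k else ?Y k))
      \<and> sorted_wrt (<) (mix x y (S - U)) \<and> pure_le a (mix x y (S - U))"
    if U: "up.admissible ?X ?Y S U" for U
  proof -
    have lo: "0 < gap (?Y k) (?X j)" if "j < k" "k < ?L" "j \<in> S - U" "k \<notin> S - U" for j k
    proof (cases "j < length y")
      case True
      then show ?thesis using trans[OF S(2) yinc] that by blast
    next
      case False
      then show ?thesis using that by (simp add: row_def)
    qed
    \<comment> \<open>The critical pair is a row j moved up to y before a row k left in x. This is
      what the order condition in \<open>admissible\<close> controls.\<close>
    have hi: "0 < gap (?X k) (?Y j)" if "j < k" "k \<in> S - U" "j \<notin> S - U" for j k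
    proof (cases "j \<in> U")
      case True
      then show ?thesis using U that xinc[of j k] S(1)[of k] by (auto simp: up.admissible_def)
    next
      case False
      then have "j \<notin> S" "k < ?L" using that S(1) by auto
      then show ?thesis using cases[of j] xinc[OF that(1)] trans[OF T(2), of j "?X k"] that(1) by auto
    qed
    have sub: "S - U \<subseteq> {..<?L}" using S by auto
    show ?thesis by (intro conjI allI mix_in_P[OF x y len sub lo hi] a)
  qed
  have mixT: "mix x y (T - U) \<in> P n M N s \<and> length y \<le> length (mix x y (T - U))
      \<and> length (mix x y (T - U)) \<le> ?L
      \<and> (\<forall>k. row (mix x y (T - U)) k = (if k \<in> T - U then ?X k else ?Y k))
      \<and> sorted_wrt (<) (mix x y (T - U)) \<and> pure_le a (mix x y (T - U))"
    if U: "dn.admissible ?X ?Y T U" for U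
  proof -
    have lo: "0 < gap (?Y k) (?X j)" if "j < k" "k < ?L" "j \<in> T - U" "k \<notin> T - U" for j k
    proof (cases "k \<in> U")
      case True
      then show ?thesis using U that xinc[of j k] by (auto simp: dn.admissible_def)
    next
      case False
      then have "k \<notin> T" using that by auto
      then show ?thesis
        using cases[OF that(2)] xinc[OF that(1,2)] trans[OF xinc[OF that(1,2)] S(2)] by auto
    qed
    have hi: "0 < gap (?X k) (?Y j)" if "j < k" "k \<in> T - U" "j \<notin> T - U" for j k
      using trans[OF yinc[OF that(1)] T(2)[of k]] Ty[of k] that by auto
    have sub: "T - U \<subseteq> {..<?L}" using T by auto
    show ?thesis by (intro conjI allI mix_in_P[OF x y len sub lo hi] a)
  qed
  \<comment> \<open>The length bound keeps the codimension at least that of y, so that all diagrams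
    used satisfy the moment equations that determine pi(y) up to a scalar.\<close>
  define F where "F = {d \<in> P n M N s. pure_le a d \<and> length y \<le> length d}"
  have finF: "finite F" using finite_P[of n M N s] by (simp add: F_def)
  have subS: "S \<subseteq> {..<?L}" and subT: "T \<subseteq> {..<?L}" using S T by auto
  have finS: "finite S" "finite T" using subS subT finite_subset by auto
  \<comment> \<open>For r in T and q in S, q < r gives x_q < y_q < y_r < x_r, while q > r gives y_r
    < x_r < x_q < y_q. So no move in S crosses x_r, and all factors are positive.\<close>
  have strictS: "up.strictly_representable ?X ?Y S (\<lambda>q. \<Prod>r\<in>T. gap (?Y r) (?X q) / gap (?X r) (?X q))"
  proof (rule up.strictly_representable_prod)
    have "gap (?X q) (?X q') \<noteq> 0" if "q \<in> S" "q' \<in> S" "q \<noteq> q'" for q q'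
      using xinc[of q q'] xneg[of q' q] S(1)[OF that(1)] S(1)[OF that(2)] that(3)
      by (metis gap_eq_0_iff linorder_neqE_nat order_less_irrefl)
    then show "up.chain_compatible ?X ?Y S"
      using trans[OF _ S(2)] by (auto simp: up.chain_compatible_def)
    fix r assume r: "r \<in> T"
    show "0 < gap (?X r) (?Y r)" using T(2)[OF r] .
    have q1: "0 < gap (?X r) (?X q)" "0 < gap (?X r) (?Y q)" "0 < gap (?Y r) (?X q)"
      if "q \<in> S" "q < r" for q
    proof -
      have "0 < gap (?Y r) (?Y q)" using yinc[OF that(2)] Ty[OF r] that(2) by simp
      then show "0 < gap (?X r) (?X q)" "0 < gap (?X r) (?Y q)" "0 < gap (?Y r) (?X q)"
        using xinc[OF that(2) T(1)[OF r]] trans T(2)[OF r] S(2)[OF that(1)] by blast+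
    qed
    have q2: "gap (?X r) (?X q) < 0" "gap (?X r) (?Y q) < 0" "gap (?Y r) (?X q) < 0"
      if "q \<in> S" "r < q" for q
      using xinc[OF that(2) S(1)[OF that(1)]] trans[OF _ S(2)[OF that(1)]] trans[OF T(2)[OF r]] neg
      by blast+
    have rq: "q < r \<or> r < q" if "q \<in> S" for q
      using that r ST by (metis disjoint_iff linorder_neqE_nat)
    show "0 < gap (?Y r) (?X q) / gap (?X r) (?X q)" if "q \<in> S" for q
      using rq[OF that] q1[OF that] q2[OF that] by (auto simp: divide_neg_neg)
    have "0 < gap (?X r) (?X q) * gap (?X r) (?Y q)" if "q \<in> S" for q
      using rq[OF that] q1[OF that] q2[OF that] by (auto simp: mult_neg_neg)
    moreover have "0 < gap (?X q') (?Y q)"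
      if "q \<in> S" "q' \<in> S" "gap (?X r) (?X q) * gap (?X r) (?X q') < 0" "0 < gap (?X q') (?X q)" for q q'
    proof -
      have "q < q'" using idx[OF that(4) S(1)[OF that(1)]] .
      then have "q < r" "r < q'"
        using that(3) rq[OF that(1)] rq[OF that(2)] q1[OF that(1)] q1[OF that(2)] q2[OF that(1)] q2[OF that(2)]
        by (auto simp: mult_less_0_iff)
      then show ?thesis using trans[OF q1(2)[OF that(1)] xinc] S(1)[OF that(2)] by blast
    qed
    ultimately show "up.separates ?X ?Y S (?X r)" by (auto simp: up.separates_def)
  qed (use finS in auto)
  \<comment> \<open>In the reversed order the rows of T are the ones that move up from x to y, so
    the argument for S applies with the roles exchanged.\<close>
  have strictT: "dn.strictly_representable ?X ?Y T (\<lambda>q. \<Prod>r\<in>S. ?D (?Y r) (?X q) / ?D (?X r) (?X q))"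
  proof (rule dn.strictly_representable_prod)
    have "gap (?X q') (?X q) \<noteq> 0" if "q \<in> T" "q' \<in> T" "q \<noteq> q'" for q q'
      using xinc[of q q'] xneg[of q' q] T(1)[OF that(1)] T(1)[OF that(2)] that(3)
      by (metis gap_eq_0_iff linorder_neqE_nat order_less_irrefl)
    then show "dn.chain_compatible ?X ?Y T"
      using trans[OF T(2)] by (auto simp: dn.chain_compatible_def)
    fix r assume r: "r \<in> S"
    show "0 < gap (?Y r) (?X r)" using S(2)[OF r] .
    have q1: "gap (?X q) (?X r) < 0" "gap (?Y q) (?X r) < 0" "gap (?X q) (?Y r) < 0"
      if "q \<in> T" "q < r" for q
      using xinc[OF that(2) S(1)[OF r]] trans[OF T(2)[OF that(1)]] trans[OF _ S(2)[OF r]] neg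
      by blast+
    have q2: "0 < gap (?X q) (?X r)" "0 < gap (?Y q) (?X r)" "0 < gap (?X q) (?Y r)"
      if "q \<in> T" "r < q" for q
    proof -
      have "0 < gap (?Y q) (?Y r)" using yinc[OF that(2)] Ty[OF that(1)] that(2) by simp
      then show "0 < gap (?X q) (?X r)" "0 < gap (?Y q) (?X r)" "0 < gap (?X q) (?Y r)"
        using xinc[OF that(2) T(1)[OF that(1)]] trans S(2)[OF r] T(2)[OF that(1)] by blast+
    qed
    have rq: "q < r \<or> r < q" if "q \<in> T" for q
      using that r ST by (metis disjoint_iff linorder_neqE_nat)
    show "0 < gap (?X q) (?Y r) / gap (?X q) (?X r)" if "q \<in> T" for q
      using rq[OF that] q1[OF that] q2[OF that] by (auto simp: divide_neg_neg)
    have "0 < gap (?X q) (?X r) * gap (?Y q) (?X r)" if "q \<in> T" for q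
      using rq[OF that] q1[OF that] q2[OF that] by (auto simp: mult_neg_neg)
    moreover have "0 < gap (?Y q) (?X q')"
      if "q \<in> T" "q' \<in> T" "gap (?X q) (?X r) * gap (?X q') (?X r) < 0" "0 < gap (?X q) (?X q')" for q q'
    proof -
      have "q' < q" using idx[OF that(4) T(1)[OF that(2)]] .
      then have "r < q" "q' < r"
        using that(3) rq[OF that(1)] rq[OF that(2)] q1[OF that(1)] q1[OF that(2)] q2[OF that(1)] q2[OF that(2)]
        by (auto simp: mult_less_0_iff)
      then show ?thesis using trans[OF xinc q2(2)[OF that(1)]] S(1)[OF r] by blast
    qed
    ultimately show "dn.separates ?X ?Y T (?X r)" by (auto simp: dn.separates_def)
  qed (use finS in auto)
  have "\<exists>e>0. \<exists>\<gamma>\<in>cone F.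
      (\<forall>q\<in>S. pure_diagram x q (x ! q) = e * pure_diagram (mix x y S) q (x ! q) + \<gamma> q (x ! q))
    \<and> (\<forall>i j. \<gamma> i j \<noteq> 0 \<longrightarrow> i \<in> S \<and> row x i = Some j \<or> row y i = Some j)"
  proof (rule exchange_stage[OF bracket_gap, where \<sigma> = 1 and R = T])
    show "mix x y (S - U) \<in> F \<and> length (mix x y (S - U)) \<le> length x \<and> sorted_wrt (<) (mix x y (S - U))
       \<and> (\<forall>k. row (mix x y (S - U)) k = (if k \<in> S - U then row x k else row y k))"
      if "up.admissible ?X ?Y S U" for U
      using mixS[OF that] by (auto simp: F_def)
    show "row x k \<noteq> row y k" if "k \<in> S" for k using S(2)[OF that] by (metis gap_eq_0_iff order_less_irrefl)
  qed (use subS subT ST cases strictS finF in auto)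
  then obtain e \<gamma> where e: "0 < e" "\<gamma> \<in> cone F"
    "\<And>q. q \<in> S \<Longrightarrow> pure_diagram x q (x ! q) = e * pure_diagram (mix x y S) q (x ! q) + \<gamma> q (x ! q)"
    "\<And>i j. \<gamma> i j \<noteq> 0 \<Longrightarrow> i \<in> S \<and> row x i = Some j \<or> row y i = Some j" by auto
  have "\<exists>e>0. \<exists>\<gamma>\<in>cone F.
      (\<forall>q\<in>T. pure_diagram x q (x ! q) = e * pure_diagram (mix x y T) q (x ! q) + \<gamma> q (x ! q))
    \<and> (\<forall>i j. \<gamma> i j \<noteq> 0 \<longrightarrow> i \<in> T \<and> row x i = Some j \<or> row y i = Some j)"
  proof (rule exchange_stage[OF bracket_gap_swap, where \<sigma> = "-1" and R = S])
    show "gap b a = - 1 * gap a b" for a b using gap_swap[of b a] by simp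
    show "mix x y (T - U) \<in> F \<and> length (mix x y (T - U)) \<le> length x \<and> sorted_wrt (<) (mix x y (T - U))
       \<and> (\<forall>k. row (mix x y (T - U)) k = (if k \<in> T - U then row x k else row y k))"
      if "dn.admissible ?X ?Y T U" for U
      using mixT[OF that] by (auto simp: F_def)
    show "row x k \<noteq> row y k" if "k \<in> T" for k using T(2)[OF that] by (metis gap_eq_0_iff order_less_irrefl)
  qed (use subS subT ST cases strictT finF in auto)
  then obtain e' \<gamma>' where e': "0 < e'" "\<gamma>' \<in> cone F"
    "\<And>q. q \<in> T \<Longrightarrow> pure_diagram x q (x ! q) = e' * pure_diagram (mix x y T) q (x ! q) + \<gamma>' q (x ! q)"
    "\<And>i j. \<gamma>' i j \<noteq> 0 \<Longrightarrow> i \<in> T \<and> row x i = Some j \<or> row y i = Some j" by auto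
  note mS = mixS[OF up.admissible_empty, simplified] and mT = mixT[OF dn.admissible_empty, simplified]
  define \<delta> where "\<delta> i j = e' * pure_diagram (mix x y T) i j + \<gamma>' i j" for i j
  have \<delta>F: "\<delta> \<in> cone F" unfolding \<delta>_def
    using e' mT finF by (intro cone_add cone_scale pure_diagram_in_cone) (auto simp: F_def)
  have \<delta>0: "i \<in> T \<and> row x i = Some j \<or> row y i = Some j" if "\<delta> i j \<noteq> 0" for i j
  proof (cases "\<gamma>' i j = 0")
    case True
    then have "row (mix x y T) i = Some j"
      using that pure_diagram_eq_0[of i "mix x y T" j] by (auto simp: \<delta>_def row_eq_Some_iff)
    then show ?thesis using mT by (auto split: if_splits)
  qed (use e'(4) in blast)
  define \<epsilon> where "\<epsilon> i j = e * pure_diagram (mix x y S) i j + \<gamma> i j" for i j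
  have \<epsilon>F: "\<epsilon> \<in> cone F" unfolding \<epsilon>_def
    using e mS finF by (intro cone_add cone_scale pure_diagram_in_cone) (auto simp: F_def)
  have \<epsilon>0: "i \<in> S \<and> row x i = Some j \<or> row y i = Some j" if "\<epsilon> i j \<noteq> 0" for i j
  proof (cases "\<gamma> i j = 0")
    case True
    then have "row (mix x y S) i = Some j"
      using that pure_diagram_eq_0[of i "mix x y S" j] by (auto simp: \<epsilon>_def row_eq_Some_iff)
    then show ?thesis using mS by (auto split: if_splits)
  qed (use e(4) in blast)
  define \<rho> where "\<rho> i j = pure_diagram x i j - \<epsilon> i j - \<delta> i j" for i j
  have FP: "F \<subseteq> P n M N (length y - 1)" by (auto simp: F_def P_def codim_def)
  have "\<rho> \<in> Bs n M N (length y - 1)"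
  proof -
    have "x \<in> P n M N (length y - 1)" using x len by (auto simp: P_def codim_def)
    then have "(\<lambda>i j. 1 * pure_diagram x i j + (-1) * \<epsilon> i j) \<in> Bs n M N (length y - 1)"
      using cone_subset_Bs[OF FP finF] \<epsilon>F by (intro Bs_combination pure_diagram_in_Bs) auto
    from Bs_combination[OF this subsetD[OF cone_subset_Bs[OF FP finF] \<delta>F], of 1 "-1"]
    show ?thesis by (simp add: \<rho>_def[abs_def])
  qed
  moreover have "i < length y \<and> j = y ! i" if "\<rho> i j \<noteq> 0" for i j
  proof (rule ccontr)
    assume ny: "\<not> (i < length y \<and> j = y ! i)"
    then have ry: "row y i \<noteq> Some j" by (auto simp: row_eq_Some_iff)
    show False
    proof (cases "row x i = Some j")
      case False
      then have "pure_diagram x i j = 0" "\<epsilon> i j = 0" "\<delta> i j = 0"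
        using pure_diagram_eq_0[of i x j] \<epsilon>0[of i j] \<delta>0[of i j] ry by (auto simp: row_eq_Some_iff)
      then show False using that by (simp add: \<rho>_def)
    next
      case True
      then have j: "i < ?L" "x ! i = j" by (auto simp: row_eq_Some_iff)
      consider "i \<in> S" | "i \<in> T" using cases[OF j(1)] True ry by auto
      then show False
      proof cases
        case 1
        then have "\<delta> i j = 0" using \<delta>0[of i j] ry ST by auto
        then show False using that e(3)[OF 1] j by (simp add: \<rho>_def \<epsilon>_def)
      next
        case 2
        then have "\<epsilon> i j = 0" using \<epsilon>0[of i j] ry ST by auto
        then show False using that e'(3)[OF 2] j by (simp add: \<rho>_def \<delta>_def)
      qed
    qed
  qed
  ultimately obtain c where c: "\<And>i j. \<rho> i j = c * pure_diagram y i j"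
    using supported_eq_multiple_pure_diagram[of \<rho> n M N y] y by (auto simp: P_def)
  \<comment> \<open>The sign of c is not known; C compensates a negative one.\<close>
  define C where "C = max 0 (- c)"
  have yF: "y \<in> F" using y a by (simp add: F_def)
  have "(\<lambda>i j. \<gamma> i j + (\<delta> i j + (C + c) * pure_diagram y i j)) \<in> cone F"
    using finF e(2) \<delta>F yF by (intro cone_add cone_scale pure_diagram_in_cone) (auto simp: C_def)
  also have "(\<lambda>i j. \<gamma> i j + (\<delta> i j + (C + c) * pure_diagram y i j)) =
    (\<lambda>i j. pure_diagram x i j + C * pure_diagram y i j - e * pure_diagram (mix x y S) i j)"
  proof (intro ext)
    fix i j
    show "\<gamma> i j + (\<delta> i j + (C + c) * pure_diagram y i j) =
      pure_diagram x i j + C * pure_diagram y i j - e * pure_diagram (mix x y S) i j"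
      using c[of i j] by (simp add: \<rho>_def \<epsilon>_def algebra_simps)
  qed
  finally have incone: "(\<lambda>i j. pure_diagram x i j + C * pure_diagram y i j - e * pure_diagram (mix x y S) i j)
      \<in> cone {d \<in> P n M N s. pure_le a d}"
    using cone_mono[of F "{d \<in> P n M N s. pure_le a d}"] finite_P[of n M N s]
    by (auto simp: F_def)
  have le: "pure_le (mix x y S) x" "pure_le (mix x y S) y"
  proof -
    \<comment> \<open>The meet is as long as x, since all rows of x past the end of y are in
      S.\<close>
    have Slen: "length (mix x y S) = ?L"
    proof (rule ccontr)
      assume "length (mix x y S) \<noteq> ?L"
      then have l: "length (mix x y S) < ?L" "length y \<le> length (mix x y S)" using mS by auto
      then have "length (mix x y S) \<in> S" by (auto simp: S_def row_def)
      then have "row (mix x y S) (length (mix x y S)) = row x (length (mix x y S))" using mS by auto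
      then show False using l by (simp add: row_def)
    qed
    have "mix x y S ! k \<le> x ! k \<and> (k < length y \<longrightarrow> mix x y S ! k \<le> y ! k)" if "k < ?L" for k
    proof -
      have "row (mix x y S) k = (if k \<in> S then row x k else row y k)" using mS by blast
      moreover have "k \<in> S \<Longrightarrow> k < length y \<Longrightarrow> x ! k < y ! k"
        using S(2)[of k] that by (simp add: row_def)
      moreover have "k \<in> T \<Longrightarrow> y ! k < x ! k" using T(2)[of k] Ty[of k] that by (simp add: row_def)
      ultimately show ?thesis using cases[OF that] that Slen Ty[of k]
        by (auto simp: row_def split: if_splits)
    qed
    then show "pure_le (mix x y S) x" "pure_le (mix x y S) y"
      using Slen len by (auto simp: pure_le_def)
  qed
  have "0 \<le> C" by (simp add: C_def)
  then show ?thesis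
    using mS e(1)
    by (intro exI[of _ "mix x y S"] exI[of _ e] exI[of _ C] conjI le incone) simp_all
qed

section \<open>Polyhedral cones and chain decompositions\<close>

definition linear_functional :: "(diagram \<Rightarrow> rat) \<Rightarrow> bool" where
  "linear_functional f \<longleftrightarrow> (\<forall>u v a. f (\<lambda>i j. u i j + a * v i j) = f u + a * f v)"

lemma linear_functional_diff:
  assumes "linear_functional f"
  shows "f (\<lambda>i j. u i j - a * v i j) = f u - a * f v"
proof -
  have "f (\<lambda>i j. u i j + (- a) * v i j) = f u + (- a) * f v"
    using assms unfolding linear_functional_def by blast
  then show ?thesis by simp
qed

lemma cone_insert:
  assumes "finite C"
  shows "\<beta> \<in> cone (insert d C) \<longleftrightarrow> (\<exists>a\<ge>0. (\<lambda>i j. \<beta> i j - a * pure_diagram d i j) \<in> cone C)"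
proof
  assume "\<beta> \<in> cone (insert d C)"
  then obtain c where c: "\<forall>d\<in>insert d C. 0 \<le> c d"
    "\<beta> = (\<lambda>i j. \<Sum>d\<in>insert d C. c d * pure_diagram d i j)" by (auto simp: cone_def)
  show "\<exists>a\<ge>0. (\<lambda>i j. \<beta> i j - a * pure_diagram d i j) \<in> cone C"
  proof (cases "d \<in> C")
    case True
    then have "(\<lambda>i j. \<beta> i j - 0 * pure_diagram d i j) \<in> cone C"
      using c by (auto simp: cone_def insert_absorb)
    then show ?thesis by blast
  next
    case False
    then have "(\<lambda>i j. \<beta> i j - c d * pure_diagram d i j) \<in> cone C"
      using c assms by (auto simp: cone_def)
    then show ?thesis using c(1) by blast
  qed
next
  assume "\<exists>a\<ge>0. (\<lambda>i j. \<beta> i j - a * pure_diagram d i j) \<in> cone C"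
  then obtain a where a: "a \<ge> 0" "(\<lambda>i j. \<beta> i j - a * pure_diagram d i j) \<in> cone C" by blast
  have "(\<lambda>i j. (\<beta> i j - a * pure_diagram d i j) + a * pure_diagram d i j) \<in> cone (insert d C)"
    using a assms cone_mono[of C "insert d C"]
    by (intro cone_add cone_scale pure_diagram_in_cone) auto
  then show "\<beta> \<in> cone (insert d C)" by simp
qed

text \<open>Fourier--Motzkin elimination of the coefficient of one generator at a time.\<close>
lemma cone_polyhedral:
  assumes "finite C" "finite I" "\<And>d i j. d \<in> C \<Longrightarrow> (i, j) \<notin> I \<Longrightarrow> pure_diagram d i j = 0"
  shows "\<exists>E. finite E \<and> (\<forall>f\<in>E. linear_functional f) \<and>
    (\<forall>\<beta>. (\<forall>i j. (i, j) \<notin> I \<longrightarrow> \<beta> i j = 0) \<longrightarrow> \<beta> \<in> cone C \<longleftrightarrow> (\<forall>f\<in>E. 0 \<le> f \<beta>))"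
  using assms(1,3)
proof (induction C rule: finite_induct)
  case empty
  define E where "E = (\<lambda>(i, j) \<beta>. \<beta> i j) ` I \<union> (\<lambda>(i, j) \<beta>. - \<beta> i j :: rat) ` I"
  have "finite E" using assms(2) by (simp add: E_def)
  moreover have "\<forall>f\<in>E. linear_functional f" by (auto simp: E_def linear_functional_def)
  moreover have "\<beta> \<in> cone {} \<longleftrightarrow> (\<forall>f\<in>E. 0 \<le> f \<beta>)" if "\<forall>i j. (i, j) \<notin> I \<longrightarrow> \<beta> i j = 0" for \<beta>
  proof -
    have "\<beta> \<in> cone {} \<longleftrightarrow> (\<forall>i j. \<beta> i j = 0)" by (auto simp: cone_def)
    also have "\<dots> \<longleftrightarrow> (\<forall>(i, j)\<in>I. 0 \<le> \<beta> i j \<and> 0 \<le> - \<beta> i j)" using that by force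
    also have "\<dots> \<longleftrightarrow> (\<forall>f\<in>E. 0 \<le> f \<beta>)"
      by (simp add: E_def ball_Un case_prod_beta ball_conj_distrib)
    finally show ?thesis .
  qed
  ultimately show ?case by blast
next
  case (insert d C)
  have "\<And>d i j. d \<in> C \<Longrightarrow> (i, j) \<notin> I \<Longrightarrow> pure_diagram d i j = 0"
    using insert.prems by blast
  from insert.IH[OF this] obtain E where E: "finite E" "\<forall>f\<in>E. linear_functional f"
    "\<And>\<beta>. \<forall>i j. (i, j) \<notin> I \<longrightarrow> \<beta> i j = 0 \<Longrightarrow> \<beta> \<in> cone C \<longleftrightarrow> (\<forall>f\<in>E. 0 \<le> f \<beta>)"
    by auto
  let ?p = "pure_diagram d"
  define Ep where "Ep = {f \<in> E. 0 < f ?p}"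
  define En where "En = {f \<in> E. f ?p < 0}"
  \<comment> \<open>\<open>En\<close> bounds the new coefficient from below and \<open>Ep\<close>
    from above. The combination for a pair vanishes at \<open>?p\<close> and says that the lower
    bound does not exceed the upper one; the first set compares the upper bounds with 0.\<close>
  define E' where "E' = {f \<in> E. 0 \<le> f ?p} \<union> (\<lambda>(f, g) \<beta>. f \<beta> * (- g ?p) + g \<beta> * f ?p) ` (Ep \<times> En)"
  have "finite E'" using E(1) by (simp add: E'_def Ep_def En_def)
  moreover have "\<forall>f\<in>E'. linear_functional f"
  proof -
    have "linear_functional (\<lambda>\<beta>. f \<beta> * a + g \<beta> * b)"
      if "linear_functional f" "linear_functional g" for f g a b
      using that unfolding linear_functional_def by (simp add: algebra_simps)
    then show ?thesis using E(2) by (auto simp: E'_def Ep_def En_def simp del: mult_minus_right)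
  qed
  moreover have "\<beta> \<in> cone (insert d C) \<longleftrightarrow> (\<forall>f\<in>E'. 0 \<le> f \<beta>)"
    if \<beta>: "\<forall>i j. (i, j) \<notin> I \<longrightarrow> \<beta> i j = 0" for \<beta>
  proof -
    have "(\<lambda>i j. \<beta> i j - a * ?p i j) \<in> cone C \<longleftrightarrow> (\<forall>f\<in>E. a * f ?p \<le> f \<beta>)" for a
    proof -
      have "(\<lambda>i j. \<beta> i j - a * ?p i j) \<in> cone C \<longleftrightarrow> (\<forall>f\<in>E. 0 \<le> f (\<lambda>i j. \<beta> i j - a * ?p i j))"
        by (rule E(3)) (simp add: \<beta> insert.prems[of d])
      also have "\<dots> \<longleftrightarrow> (\<forall>f\<in>E. a * f ?p \<le> f \<beta>)"
        by (intro ball_cong refl) (simp add: linear_functional_diff[OF bspec[OF E(2)]])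
      finally show ?thesis .
    qed
    then have "\<beta> \<in> cone (insert d C) \<longleftrightarrow> (\<exists>a\<ge>0. \<forall>f\<in>E. a * f ?p \<le> f \<beta>)"
      using cone_insert[OF insert.hyps(1)] by simp
    also have "\<dots> \<longleftrightarrow> (\<forall>f\<in>E'. 0 \<le> f \<beta>)"
    proof
      assume "\<exists>a\<ge>0. \<forall>f\<in>E. a * f ?p \<le> f \<beta>"
      then obtain a where a: "0 \<le> a" "\<And>f. f \<in> E \<Longrightarrow> a * f ?p \<le> f \<beta>" by blast
      have "0 \<le> f \<beta>" if "f \<in> E" "0 \<le> f ?p" for f
        using a(2)[OF that(1)] mult_nonneg_nonneg[OF a(1) that(2)] by simp
      moreover have "0 \<le> f \<beta> * (- g ?p) + g \<beta> * f ?p" if "f \<in> Ep" "g \<in> En" for f g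
      proof -
        have "a * f ?p * (- g ?p) \<le> f \<beta> * (- g ?p)" "a * g ?p * f ?p \<le> g \<beta> * f ?p"
          using that a(2) by (auto simp: Ep_def En_def intro!: mult_right_mono mult_right_mono_neg)
        then show ?thesis by (simp add: mult_ac)
      qed
      ultimately show "\<forall>f\<in>E'. 0 \<le> f \<beta>" by (auto simp: E'_def)
    next
      assume pos: "\<forall>f\<in>E'. 0 \<le> f \<beta>"
      \<comment> \<open>\<open>Max A\<close> is the least coefficient that meets all lower bounds, 0
        being one of them.\<close>
      define A where "A = insert 0 ((\<lambda>g. g \<beta> / g ?p) ` En)"
      have finA: "finite A" "A \<noteq> {}" using E(1) by (auto simp: A_def En_def)
      have "Max A * f ?p \<le> f \<beta>" if f: "f \<in> E" for f
      proof (cases "f ?p" "0 :: rat" rule: linorder_cases)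
        case less
        then have "f \<beta> / f ?p \<le> Max A" using f finA by (intro Max_ge) (auto simp: A_def En_def)
        then show ?thesis using less by (simp add: neg_divide_le_eq)
      next
        case equal
        then show ?thesis using pos f by (simp add: E'_def)
      next
        case greater
        have "b * f ?p \<le> f \<beta>" if b: "b \<in> A" for b
        proof (cases "b = 0")
          case True
          then show ?thesis using pos f greater by (simp add: E'_def)
        next
          case False
          then obtain g where g: "g \<in> En" "b = g \<beta> / g ?p" using b by (auto simp: A_def)
          have "f \<in> Ep" using f greater by (simp add: Ep_def)
          then have "(\<lambda>\<beta>. f \<beta> * (- g ?p) + g \<beta> * f ?p) \<in> E'" using g(1) by (force simp: E'_def)
          from bspec[OF pos this] have "0 \<le> f \<beta> * (- g ?p) + g \<beta> * f ?p" .
          then have "f \<beta> * g ?p \<le> g \<beta> * f ?p" by simp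
          moreover have "g ?p < 0" using g(1) by (simp add: En_def)
          ultimately show ?thesis by (simp add: g(2) neg_divide_le_eq)
        qed
        then show ?thesis using Max_in[OF finA] by blast
      qed
      moreover have "0 \<le> Max A" using finA by (intro Max_ge) (auto simp: A_def)
      ultimately show "\<exists>a\<ge>0. \<forall>f\<in>E. a * f ?p \<le> f \<beta>" by blast
    qed
    finally show ?thesis .
  qed
  ultimately show ?case by blast
qed

text \<open>In row 0 all differences of degrees are positive. This bounds the multiple of a pure
  diagram that can be subtracted inside a cone.\<close>

lemma pure_diagram_row_0:
  assumes "degseq n d"
  shows "0 < pure_diagram d 0 (d ! 0)" "0 \<le> pure_diagram d 0 j"
proof -
  have "0 < (\<Prod>k\<in>{0..<length d} - {0}. 1 / rat_of_int (d ! k - d ! 0))"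
    using degseq_nth_less[OF assms, of 0] by (intro prod_pos) auto
  then show "0 < pure_diagram d 0 (d ! 0)" "0 \<le> pure_diagram d 0 j"
    using assms by (auto simp: pure_diagram_def degseq_def)
qed

text \<open>By \<open>cone_polyhedral\<close> the possible multiples are cut out by finitely many
  weak inequalities with rational bounds, so the supremum is rational and attained.\<close>

lemma cone_maximal_multiple:
  assumes "finite C" "\<And>d. d \<in> C \<Longrightarrow> degseq n d" "m \<in> C" "\<beta> \<in> cone C"
  obtains a where "0 \<le> a" "(\<lambda>i j. \<beta> i j - a * pure_diagram m i j) \<in> cone C"
    "\<And>e. 0 < e \<Longrightarrow> (\<lambda>i j. \<beta> i j - a * pure_diagram m i j - e * pure_diagram m i j) \<notin> cone C"
proof -
  let ?p = "pure_diagram m"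
  define I where "I = (\<Union>d\<in>C. (\<lambda>i. (i, d ! i)) ` {..<length d})"
  have finI: "finite I" using assms(1) by (simp add: I_def)
  have I: "pure_diagram d i j = 0" if "d \<in> C" "(i, j) \<notin> I" for d i j
    using that by (intro pure_diagram_eq_0) (auto simp: I_def)
  obtain E where E: "finite E" "\<forall>f\<in>E. linear_functional f"
    "\<And>\<beta>. \<forall>i j. (i, j) \<notin> I \<longrightarrow> \<beta> i j = 0 \<Longrightarrow> \<beta> \<in> cone C \<longleftrightarrow> (\<forall>f\<in>E. 0 \<le> f \<beta>)"
    using cone_polyhedral[OF assms(1) finI I] by blast
  have \<beta>I: "\<beta> i j = 0" if "(i, j) \<notin> I" for i j
    using assms(4) I that by (auto simp: cone_def intro!: sum.neutral)
  have iff: "(\<lambda>i j. \<beta> i j - b * ?p i j) \<in> cone C \<longleftrightarrow> (\<forall>f\<in>E. b * f ?p \<le> f \<beta>)" for b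
  proof -
    have "(\<lambda>i j. \<beta> i j - b * ?p i j) \<in> cone C \<longleftrightarrow> (\<forall>f\<in>E. 0 \<le> f (\<lambda>i j. \<beta> i j - b * ?p i j))"
      by (rule E(3)) (simp add: \<beta>I I[OF assms(3)])
    also have "\<dots> \<longleftrightarrow> (\<forall>f\<in>E. b * f ?p \<le> f \<beta>)"
      by (intro ball_cong refl) (simp add: linear_functional_diff[OF bspec[OF E(2)]])
    finally show ?thesis .
  qed
  have f0: "0 \<le> f \<beta>" if "f \<in> E" for f using iff[of 0] assms(4) that by simp
  define F where "F = {f \<in> E. 0 < f ?p}"
  define A where "A = (\<lambda>f. f \<beta> / f ?p) ` F"
  have "F \<noteq> {}"
  proof
    assume "F = {}"
    then have np: "f ?p \<le> 0" if "f \<in> E" for f using that by (auto simp: F_def not_less)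
    have pos: "0 \<le> \<gamma> 0 j" if "\<gamma> \<in> cone C" for \<gamma> j
      using that pure_diagram_row_0(2)[OF assms(2)] by (auto simp: cone_def intro!: sum_nonneg)
    \<comment> \<open>Subtracting this multiple would make the entry at (0, m ! 0) equal to
      -1.\<close>
    define b where "b = (\<beta> 0 (m ! 0) + 1) / ?p 0 (m ! 0)"
    have p: "0 < ?p 0 (m ! 0)" using pure_diagram_row_0(1)[OF assms(2)[OF assms(3)]] .
    then have "0 \<le> b" using pos[OF assms(4), of "m ! 0"] by (simp add: b_def)
    then have "(\<lambda>i j. \<beta> i j - b * ?p i j) \<in> cone C"
      unfolding iff using f0 np mult_nonneg_nonpos order_trans by blast
    from pos[OF this, of "m ! 0"] show False using p by (simp add: b_def)
  qed
  then have finA: "finite A" "A \<noteq> {}" using E(1) by (auto simp: A_def F_def)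
  have "0 \<le> Min A" using finA f0 by (auto simp: A_def F_def)
  moreover have "Min A * f ?p \<le> f \<beta>" if f: "f \<in> E" for f
  proof (cases "0 < f ?p")
    case True
    then have "Min A \<le> f \<beta> / f ?p" using finA f by (intro Min_le) (auto simp: A_def F_def)
    then show ?thesis using True by (simp add: pos_le_divide_eq)
  next
    case False
    then show ?thesis using f0[OF f] mult_nonneg_nonpos[OF \<open>0 \<le> Min A\<close>, of "f ?p"] by simp
  qed
  then have "(\<lambda>i j. \<beta> i j - Min A * ?p i j) \<in> cone C" using iff by blast
  moreover have "(\<lambda>i j. \<beta> i j - Min A * ?p i j - e * ?p i j) \<notin> cone C" if "0 < e" for e
  proof
    assume "(\<lambda>i j. \<beta> i j - Min A * ?p i j - e * ?p i j) \<in> cone C"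
    then have "(\<lambda>i j. \<beta> i j - (Min A + e) * ?p i j) \<in> cone C" by (simp add: algebra_simps)
    then have *: "(Min A + e) * f ?p \<le> f \<beta>" if "f \<in> E" for f using iff that by blast
    obtain f where f: "f \<in> E" "0 < f ?p" "Min A = f \<beta> / f ?p"
      using Min_in[OF finA] by (auto simp: A_def F_def)
    have "Min A * f ?p = f \<beta>" using f(2,3) by simp
    then have "e * f ?p \<le> 0" using *[OF f(1)] by (simp add: distrib_right)
    then show False using mult_pos_pos[OF that f(2)] by simp
  qed
  ultimately show ?thesis using that by blast
qed

section \<open>Descent to a chain\<close>

lemma pure_le_refl: "pure_le d d"
  by (simp add: pure_le_def)

lemma pure_le_trans: "pure_le a b \<Longrightarrow> pure_le b c \<Longrightarrow> pure_le a c"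
  unfolding pure_le_def by (meson order_trans order_less_le_trans)

lemma pure_le_antisym: "pure_le a b \<Longrightarrow> pure_le b a \<Longrightarrow> a = b"
  unfolding pure_le_def by (metis nth_equalityI order_antisym)

abbreviation up_set :: "nat \<Rightarrow> int \<Rightarrow> int \<Rightarrow> nat \<Rightarrow> int list \<Rightarrow> int list set" where
  "up_set n M N s a \<equiv> {d \<in> P n M N s. pure_le a d}"

text \<open>These are the generators in the smallest face of \<open>cone C\<close> containing
  \<beta>. Unlike occurring with a positive coefficient, this does not depend on a chosen
  representation of \<beta>.\<close>

definition absorbed :: "int list set \<Rightarrow> diagram \<Rightarrow> int list \<Rightarrow> bool" where
  "absorbed C \<beta> d \<longleftrightarrow> d \<in> C \<and> (\<exists>e>0. (\<lambda>i j. \<beta> i j - e * pure_diagram d i j) \<in> cone C)"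

text \<open>Half of \<beta> provides a multiple of pi(x) and the other half one of pi(y); a small
  multiple of the exchange relation trades them for a multiple of pi(m).\<close>

lemma absorbed_lower_bound:
  assumes "absorbed (up_set n M N s a) \<beta> x" "absorbed (up_set n M N s a) \<beta> y"
  shows "\<exists>m. absorbed (up_set n M N s a) \<beta> m \<and> pure_le m x \<and> pure_le m y"
  using assms
proof (induction "length y" "length x" arbitrary: x y rule: linorder_wlog)
  case (le x y)
  let ?U = "up_set n M N s a"
  have fin: "finite ?U" using finite_P[of n M N s] by simp
  obtain e1 e2 where e: "0 < e1" "(\<lambda>i j. \<beta> i j - e1 * pure_diagram x i j) \<in> cone ?U"
      "0 < e2" "(\<lambda>i j. \<beta> i j - e2 * pure_diagram y i j) \<in> cone ?U"
      and xy: "x \<in> ?U" "y \<in> ?U"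
    using le by (auto simp: absorbed_def)
  obtain m e C where m: "m \<in> ?U" "pure_le m x" "pure_le m y" "0 < e" "0 \<le> C"
    "(\<lambda>i j. pure_diagram x i j + C * pure_diagram y i j - e * pure_diagram m i j) \<in> cone ?U"
    using exchange[of x n M N s y a] xy le(1) by blast
  \<comment> \<open>Small enough that r copies of pi(x) and r * C copies of pi(y) are available. The
    denominator has C + 1 because C may be 0.\<close>
  define r where "r = min (e1 / 2) (e2 / (2 * (C + 1)))"
  have r: "0 < r" using e m(5) by (simp add: r_def)
  have r1: "r \<le> e1 / 2" unfolding r_def by (rule min.cobounded1)
  have "r * C \<le> r * (C + 1)" using r by simp
  also have "\<dots> \<le> e2 / (2 * (C + 1)) * (C + 1)"
    using m(5) by (intro mult_right_mono) (auto simp: r_def)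
  also have "\<dots> = e2 / 2" using m(5) by (simp add: field_simps)
  finally have r2: "r * C \<le> e2 / 2" .
  have "(\<lambda>i j. 1/2 * (\<beta> i j - e1 * pure_diagram x i j)
      + (1/2 * (\<beta> i j - e2 * pure_diagram y i j)
      + ((e1 / 2 - r) * pure_diagram x i j + ((e2 / 2 - r * C) * pure_diagram y i j
      + r * (pure_diagram x i j + C * pure_diagram y i j - e * pure_diagram m i j))))) \<in> cone ?U"
    using e m r r1 r2 xy by (intro cone_add cone_scale pure_diagram_in_cone fin) auto
  then have "(\<lambda>i j. \<beta> i j - (r * e) * pure_diagram m i j) \<in> cone ?U"
    by (simp add: algebra_simps)
  moreover have "0 < r * e" using r m(4) by (rule mult_pos_pos)
  ultimately show ?case using m by (auto simp: absorbed_def)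
next
  case (sym x y)
  then show ?case by blast
qed

lemma absorbed_common_lower_bound:
  assumes "finite D" "D \<noteq> {}" "\<And>d. d \<in> D \<Longrightarrow> absorbed (up_set n M N s a) \<beta> d"
  shows "\<exists>m. absorbed (up_set n M N s a) \<beta> m \<and> (\<forall>d\<in>D. pure_le m d)"
  using assms
proof (induction D rule: finite_ne_induct)
  case (singleton d)
  then show ?case using pure_le_refl by blast
next
  case (insert d D)
  then obtain m where m: "absorbed (up_set n M N s a) \<beta> m" "\<forall>d\<in>D. pure_le m d" by blast
  obtain m' where "absorbed (up_set n M N s a) \<beta> m'" "pure_le m' d" "pure_le m' m"
    using absorbed_lower_bound[OF insert.prems[of d] m(1)] by blast
  then show ?case using m(2) pure_le_trans by blast
qed

lemma up_set_cone_chain: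
  assumes "a \<in> P n M N s" "\<beta> \<in> cone (up_set n M N s a)"
  shows "\<exists>C. C \<subseteq> up_set n M N s a \<and> is_chain C \<and> \<beta> \<in> cone C"
  using assms
proof (induction "card (up_set n M N s a)" arbitrary: a \<beta> rule: less_induct)
  case less
  let ?U = "up_set n M N s"
  have fin: "finite (?U b)" for b using finite_P[of n M N s] by simp
  have aU: "a \<in> ?U a" using less.prems pure_le_refl by simp
  obtain t where t: "0 \<le> t" "(\<lambda>i j. \<beta> i j - t * pure_diagram a i j) \<in> cone (?U a)"
    "\<And>e. 0 < e \<Longrightarrow> (\<lambda>i j. \<beta> i j - t * pure_diagram a i j - e * pure_diagram a i j) \<notin> cone (?U a)"
    by (rule cone_maximal_multiple[OF fin _ aU less.prems(2)]) (auto simp: P_def)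
  define \<beta>' where "\<beta>' = (\<lambda>i j. \<beta> i j - t * pure_diagram a i j)"
  obtain c where c: "\<forall>d\<in>?U a. 0 \<le> c d" "\<beta>' = (\<lambda>i j. \<Sum>d\<in>?U a. c d * pure_diagram d i j)"
    using t(2) by (auto simp: cone_def \<beta>'_def)
  define D where "D = {d \<in> ?U a. 0 < c d}"
  have finD: "finite D" by (rule finite_subset[OF _ fin[of a]]) (auto simp: D_def)
  have sum_D: "(\<Sum>d\<in>?U a. c d * pure_diagram d i j) = (\<Sum>d\<in>D. c d * pure_diagram d i j)" for i j
    using fin[of a] c(1) by (intro sum.mono_neutral_right) (auto simp: D_def order.strict_iff_order)
  have \<beta>D: "\<beta>' \<in> cone D"
    unfolding cone_def mem_Collect_eq c(2) sum_D by (rule exI[of _ c]) (auto simp: D_def)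
  have na: "\<not> absorbed (?U a) \<beta>' a" using t(3) by (auto simp: absorbed_def \<beta>'_def)
  have "\<exists>C. C \<subseteq> ?U a \<and> is_chain C \<and> \<beta>' \<in> cone C"
  proof (cases "D = {}")
    case True
    then show ?thesis using \<beta>D by (auto simp: is_chain_def intro!: exI[of _ "{}"])
  next
    case False
    have "absorbed (?U a) \<beta>' d" if d: "d \<in> D" for d
    proof -
      have "(\<lambda>i j. \<beta>' i j - c d * pure_diagram d i j) =
          (\<lambda>i j. \<Sum>d\<in>D - {d}. c d * pure_diagram d i j)"
        unfolding c(2) sum_D by (intro ext) (simp add: sum.remove[OF finD d])
      moreover have "(\<lambda>i j. \<Sum>d\<in>D - {d}. c d * pure_diagram d i j) \<in> cone (D - {d})"
        unfolding cone_def mem_Collect_eq by (rule exI[of _ c]) (auto simp: D_def)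
      ultimately have "(\<lambda>i j. \<beta>' i j - c d * pure_diagram d i j) \<in> cone (D - {d})" by simp
      then have "(\<lambda>i j. \<beta>' i j - c d * pure_diagram d i j) \<in> cone (?U a)"
        using cone_mono[of "D - {d}" "?U a"] fin by (auto simp: D_def)
      then show ?thesis using d by (auto simp: absorbed_def D_def)
    qed
    from absorbed_common_lower_bound[OF finD False this]
    obtain m where m: "absorbed (?U a) \<beta>' m" "\<forall>d\<in>D. pure_le m d" by blast
    \<comment> \<open>Maximality of t enters here: m is absorbed and a is not, so the set above m is
      strictly smaller and the induction applies.\<close>
    have "m \<noteq> a" using m(1) na by auto
    have mU: "m \<in> P n M N s" "pure_le a m" using m(1) by (auto simp: absorbed_def)
    have "a \<notin> ?U m" using pure_le_antisym mU(2) \<open>m \<noteq> a\<close> by blast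
    moreover have sub: "?U m \<subseteq> ?U a" using pure_le_trans[OF mU(2)] by blast
    ultimately have "card (?U m) < card (?U a)" using aU fin by (intro psubset_card_mono) auto
    moreover have "D \<subseteq> ?U m" using m(2) by (auto simp: D_def)
    then have "\<beta>' \<in> cone (?U m)" using \<beta>D cone_mono fin by blast
    ultimately show ?thesis using less.hyps[of m \<beta>'] mU(1) sub by blast
  qed
  then obtain C where C: "C \<subseteq> ?U a" "is_chain C" "\<beta>' \<in> cone C" by blast
  have "is_chain (insert a C)" using C(1,2) pure_le_refl by (auto simp: is_chain_def)
  moreover have "\<beta> \<in> cone (insert a C)"
    using cone_insert[of C \<beta> a] C(1,3) t(1) fin[of a] by (auto simp: \<beta>'_def intro: finite_subset)
  ultimately show ?case using C(1) aU by (intro exI[of _ "insert a C"]) auto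
qed

theorem theorem3p5:
  fixes n :: nat and M N :: int and s :: nat
  assumes "n \<ge> 1" and "M \<le> N" and "s \<le> n"
  shows "fan n M N s \<subseteq> Bs n M N s \<and> rat_convex (fan n M N s)"
proof
  show "fan n M N s \<subseteq> Bs n M N s"
    unfolding fan_def by (rule UN_least) (simp add: cone_subset_Bs)
  txt \<open>The smallest element of \<open>P n M N s\<close>.\<close>
  define a where "a = map (\<lambda>i. M + int i) [0..<n + 1]"
  have a: "length a = n + 1" "\<And>i. i < n + 1 \<Longrightarrow> a ! i = M + int i"
    by (auto simp: a_def simp del: upt_Suc)
  have "a \<in> P n M N s"
    using a assms(2,3) by (auto simp: P_def degseq_def in_BMN_def codim_def sorted_wrt_iff_nth_less)
  have up: "up_set n M N s a = P n M N s"
    using a by (auto simp: pure_le_def P_def degseq_def in_BMN_def)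
  show "rat_convex (fan n M N s)"
    unfolding rat_convex_def
  proof (intro ballI allI impI)
    fix x y t assume xy: "x \<in> fan n M N s" "y \<in> fan n M N s" and t: "0 \<le> t \<and> t \<le> (1 :: rat)"
    have "fan n M N s \<subseteq> cone (P n M N s)"
      unfolding fan_def by (rule UN_least) (simp add: cone_mono finite_P)
    then have "(\<lambda>i j. t * x i j + (1 - t) * y i j) \<in> cone (P n M N s)"
      using xy t by (intro cone_add cone_scale) auto
    then obtain C where "C \<subseteq> P n M N s" "is_chain C" "(\<lambda>i j. t * x i j + (1 - t) * y i j) \<in> cone C"
      using up_set_cone_chain[OF \<open>a \<in> P n M N s\<close>] unfolding up by blast
    then show "(\<lambda>i j. t * x i j + (1 - t) * y i j) \<in> fan n M N s"
      using finite_subset[OF _ finite_P] by (auto simp: fan_def)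
  qed
qed

end
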